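(* Let $m\le k$ be a non-negative integer. If $w\neq 0$ (that is, on the region of the extended state space where $w\ne 0$), then $$\bar{\Omega}_m=\tilde{\Omega}_m\triangleq [\Omega_m,0_k]+ L^m .$$
   Context: System: $\dot x=f(x)u+g(x)w$, $y=h(x)$, with state $x\in M\subset\mathbb{R}^n$, $M$ open, $f,g$ smooth vector fields on $M$, $h$ a smooth scalar function on $M$, $u$ a scalar known input and $w$ a scalar unknown input (a function of time). $\mathcal{L}_\theta h=\frac{\partial h}{\partial x}\theta$ is the Lie derivative and $[a,b]=\frac{\partial b}{\partial x}a-\frac{\partial a}{\partial x}b$ the Lie bracket. Standing assumption: $L^1_g\triangleq\mathcal{L}_g h$ is nonzero everywhere on the region considered. Codistributions: spans (with smooth function coefficients) of covector (row vector) fields. For a codistribution $\Omega$, $\mathcal{L}_\theta\Omega$ is the codistribution spanned by the Lie derivatives along $\theta$ of the covectors of $\Omega$; for exact differentials the Lie derivative commutes with the differential. The sum of codistributions is the span of all generators. $\mathcal{D}$ is the differential with respect to $x$. Codistribution $\Omega_m$ on $M$: set $\phi_0=f$, $\phi_m=\frac{[\phi_{m-1},g]}{L^1_g}$. Then $\Omega_0=\mathrm{span}\{\mathcal{D}h\}$ and, for $m\ge1$, $\Omega_m=\Omega_{m-1}+\mathcal{L}_{f}\Omega_{m-1}+\mathcal{L}_{g/L^1_g}\Omega_{m-1}+\mathrm{span}\{\mathcal{L}_{\phi_{m-1}}\mathcal{D}h\}$. Extended state: for a positive integer $k$, ${}^kx=[x^T,w,w^{(1)},\dots,w^{(k-1)}]^T\in\mathbb{R}^{n+k}$,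 where $w^{(j)}=d^jw/dt^j$. On the extended space define $F=[f(x)^T,0,\dots,0]^T$ and $G=[w\,g(x)^T,w^{(1)},w^{(2)},\dots,w^{(k-1)},0]^T$. $d$ is the differential with respect to ${}^kx$. Codistribution $\bar\Omega_m$ ($m\le k$) on the extended space: $\bar\Omega_0=\mathrm{span}\{dh\}$, $\bar\Omega_m=\bar\Omega_{m-1}+\mathcal{L}_G\bar\Omega_{m-1}+\mathcal{L}_F\bar\Omega_{m-1}$. $[\Omega_m,0_k]$ is the codistribution on the extended space made by covectors whose first $n$ components form a covector of $\Omega_m$ and whose last $k$ components are zero. $L^m=\mathrm{span}\{\mathcal{L}^1_Gdh,\mathcal{L}^2_Gdh,\dots,\mathcal{L}^m_Gdh\}$ ($L^0=0$). *)

theory Defs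
  imports "HOL-Analysis.Analysis"
begin

section \<open>Smooth maps\<close>

text \<open>For open \<open>U\<close>, \<open>k_times_cont_diff_on k f U\<close> says that all directional derivatives of
  order up to \<open>k\<close> exist, as iterated Frechet derivatives, and are continuous on \<open>U\<close>.\<close>

primrec k_times_cont_diff_on ::
  "nat \<Rightarrow> ('a::real_normed_vector \<Rightarrow> 'b::real_normed_vector) \<Rightarrow> 'a set \<Rightarrow> bool" where
  "k_times_cont_diff_on 0 f U \<longleftrightarrow> continuous_on U f"
| "k_times_cont_diff_on (Suc k) f U \<longleftrightarrow>
     (\<forall>x\<in>U. f differentiable (at x)) \<and>
     (\<forall>v. k_times_cont_diff_on k (\<lambda>x. frechet_derivative f (at x) v) U)"

definition smooth_on :: "'a::real_normed_vector set \<Rightarrow> ('a \<Rightarrow> 'b::real_normed_vector) \<Rightarrow> bool" where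
  "smooth_on U f \<longleftrightarrow> (\<forall>k. k_times_cont_diff_on k f U)"

section \<open>Lie derivatives and Lie bracket\<close>

text \<open>Vector fields and covector fields are both maps \<open>'a \<Rightarrow> 'a\<close>; a row vector \<open>\<omega>\<close> is
  identified with its vector of components, so that it acts on \<open>v\<close> as \<open>\<omega> \<bullet> v\<close>.\<close>

definition differential :: "('a::euclidean_space \<Rightarrow> real) \<Rightarrow> 'a \<Rightarrow> 'a" where
  "differential h x = (\<Sum>b\<in>Basis. frechet_derivative h (at x) b *\<^sub>R b)"

definition lie_fun :: "('a::euclidean_space \<Rightarrow> 'a) \<Rightarrow> ('a \<Rightarrow> real) \<Rightarrow> 'a \<Rightarrow> real" where
  "lie_fun \<theta> h x = frechet_derivative h (at x) (\<theta> x)"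

text \<open>In row vector notation, \<open>L\<^sub>\<theta> \<omega> = \<theta>\<^sup>T (\<partial>\<omega>\<^sup>T/\<partial>x)\<^sup>T + \<omega> (\<partial>\<theta>/\<partial>x)\<close>.\<close>

definition lie_cov :: "('a::euclidean_space \<Rightarrow> 'a) \<Rightarrow> ('a \<Rightarrow> 'a) \<Rightarrow> 'a \<Rightarrow> 'a" where
  "lie_cov \<theta> \<omega> x =
     frechet_derivative \<omega> (at x) (\<theta> x)
     + (\<Sum>b\<in>Basis. (\<omega> x \<bullet> frechet_derivative \<theta> (at x) b) *\<^sub>R b)"

text \<open>Sign convention: \<open>[a, b] = (\<partial>b/\<partial>x) a - (\<partial>a/\<partial>x) b\<close>.\<close>

definition lie_bracket :: "('a::euclidean_space \<Rightarrow> 'a) \<Rightarrow> ('a \<Rightarrow> 'a) \<Rightarrow> 'a \<Rightarrow> 'a" where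
  "lie_bracket a b x =
     frechet_derivative b (at x) (a x) - frechet_derivative a (at x) (b x)"

section \<open>Codistributions\<close>

text \<open>A codistribution on the open set \<open>U\<close> is a \<open>C\<^sup>\<infinity>(U)\<close>-module of covector fields on \<open>U\<close>.
  It is represented by the set of all total functions whose restriction to \<open>U\<close> belongs to the
  module: values outside \<open>U\<close> are unconstrained, so equality of these sets is equality of the
  modules on \<open>U\<close>.\<close>

definition codist_span :: "'a::euclidean_space set \<Rightarrow> ('a \<Rightarrow> 'a) set \<Rightarrow> ('a \<Rightarrow> 'a) set" where
  "codist_span U S =
     {\<omega>. \<exists>T c. finite T \<and> T \<subseteq> S \<and> (\<forall>\<eta>\<in>T. smooth_on U (c \<eta>)) \<and>
            (\<forall>x\<in>U. \<omega> x = (\<Sum>\<eta>\<in>T. c \<eta> x *\<^sub>R \<eta> x))}"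

definition codist_sum ::
  "'a::euclidean_space set \<Rightarrow> ('a \<Rightarrow> 'a) set \<Rightarrow> ('a \<Rightarrow> 'a) set \<Rightarrow> ('a \<Rightarrow> 'a) set" where
  "codist_sum U A B = codist_span U (A \<union> B)"

definition lie_codist ::
  "'a::euclidean_space set \<Rightarrow> ('a \<Rightarrow> 'a) \<Rightarrow> ('a \<Rightarrow> 'a) set \<Rightarrow> ('a \<Rightarrow> 'a) set" where
  "lie_codist U \<theta> \<Omega> = codist_span U (lie_cov \<theta> ` \<Omega>)"

section \<open>The codistributions on the original state space\<close>

primrec phi ::
  "('a::euclidean_space \<Rightarrow> 'a) \<Rightarrow> ('a \<Rightarrow> 'a) \<Rightarrow> ('a \<Rightarrow> real) \<Rightarrow> nat \<Rightarrow> 'a \<Rightarrow> 'a" where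
  "phi f g h 0 = f"
| "phi f g h (Suc m) = (\<lambda>x. lie_bracket (phi f g h m) g x /\<^sub>R lie_fun g h x)"

primrec Omega ::
  "'a::euclidean_space set \<Rightarrow> ('a \<Rightarrow> 'a) \<Rightarrow> ('a \<Rightarrow> 'a) \<Rightarrow> ('a \<Rightarrow> real) \<Rightarrow> nat \<Rightarrow> ('a \<Rightarrow> 'a) set" where
  "Omega M f g h 0 = codist_span M {differential h}"
| "Omega M f g h (Suc m) =
     codist_sum M
       (codist_sum M
         (codist_sum M (Omega M f g h m) (lie_codist M f (Omega M f g h m)))
         (lie_codist M (\<lambda>x. g x /\<^sub>R lie_fun g h x) (Omega M f g h m)))
       (codist_span M {lie_cov (phi f g h m) (differential h)})"

section \<open>The extended state space\<close>

text \<open>The extended state \<open>(x, w, w\<^sup>(\<^sup>1\<^sup>), \<dots>, w\<^sup>(\<^sup>k\<^sup>-\<^sup>1\<^sup>))\<close> is an element \<open>(x, v)\<close> of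
  \<open>'a \<times> (real ^ 'k)\<close> with \<open>k = CARD('k)\<close>. The coordinates of \<open>v\<close> are listed by the linear order
  of \<open>'k\<close>: the least index carries \<open>w\<close>, and the index following that of \<open>w\<^sup>(\<^sup>j\<^sup>)\<close> carries
  \<open>w\<^sup>(\<^sup>j\<^sup>+\<^sup>1\<^sup>)\<close>.\<close>

type_synonym ('a, 'k) ext_state = "'a \<times> (real, 'k) vec"

definition input_val :: "real ^ 'k::{finite,linorder} \<Rightarrow> real" where
  "input_val v = v $ Min UNIV"

definition input_shift :: "real ^ 'k::{finite,linorder} \<Rightarrow> (real, 'k) vec" where
  "input_shift v = (\<chi> i. if {i<..} = {} then 0 else v $ Min {i<..})"

definition ext_F ::
  "('a::euclidean_space \<Rightarrow> 'a) \<Rightarrow> ('a, 'k::{finite,linorder}) ext_state \<Rightarrow> ('a, 'k) ext_state" where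
  "ext_F f = (\<lambda>(x, v). (f x, 0))"

definition ext_G ::
  "('a::euclidean_space \<Rightarrow> 'a) \<Rightarrow> ('a, 'k::{finite,linorder}) ext_state \<Rightarrow> ('a, 'k) ext_state" where
  "ext_G g = (\<lambda>(x, v). (input_val v *\<^sub>R g x, input_shift v))"

definition ext_h :: "('a::euclidean_space \<Rightarrow> real) \<Rightarrow> ('a, 'k::{finite,linorder}) ext_state \<Rightarrow> real" where
  "ext_h h = (\<lambda>(x, v). h x)"

definition ext_region :: "'a::euclidean_space set \<Rightarrow> ('a, 'k::{finite,linorder}) ext_state set" where
  "ext_region M = {(x, v). x \<in> M \<and> input_val v \<noteq> 0}"

primrec ext_Omega ::
  "('a::euclidean_space, 'k::{finite,linorder}) ext_state set \<Rightarrow> ('a \<Rightarrow> 'a) \<Rightarrow> ('a \<Rightarrow> 'a) \<Rightarrow>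
   ('a \<Rightarrow> real) \<Rightarrow> nat \<Rightarrow> (('a, 'k) ext_state \<Rightarrow> ('a, 'k) ext_state) set" where
  "ext_Omega U f g h 0 = codist_span U {differential (ext_h h)}"
| "ext_Omega U f g h (Suc m) =
     codist_sum U
       (codist_sum U (ext_Omega U f g h m) (lie_codist U (ext_G g) (ext_Omega U f g h m)))
       (lie_codist U (ext_F f) (ext_Omega U f g h m))"

text \<open>\<open>[\<Omega>, 0\<^sub>k]\<close>, with coefficients that are smooth functions of the extended state.\<close>

definition codist_lift ::
  "('a::euclidean_space, 'k::{finite,linorder}) ext_state set \<Rightarrow> ('a \<Rightarrow> 'a) set \<Rightarrow>
   (('a, 'k) ext_state \<Rightarrow> ('a, 'k) ext_state) set" where
  "codist_lift U \<Omega> = codist_span U ((\<lambda>\<omega> (x, v). (\<omega> x, 0)) ` \<Omega>)"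

definition L_codist ::
  "('a::euclidean_space, 'k::{finite,linorder}) ext_state set \<Rightarrow> ('a \<Rightarrow> 'a) \<Rightarrow>
   ('a \<Rightarrow> real) \<Rightarrow> nat \<Rightarrow> (('a, 'k) ext_state \<Rightarrow> ('a, 'k) ext_state) set" where
  "L_codist U g h m =
     codist_span U {(lie_cov (ext_G g) ^^ j) (differential (ext_h h)) | j. 1 \<le> j \<and> j \<le> m}"

definition tilde_Omega ::
  "'a::euclidean_space set \<Rightarrow> ('a, 'k::{finite,linorder}) ext_state set \<Rightarrow> ('a \<Rightarrow> 'a) \<Rightarrow> ('a \<Rightarrow> 'a) \<Rightarrow>
   ('a \<Rightarrow> real) \<Rightarrow> nat \<Rightarrow> (('a, 'k) ext_state \<Rightarrow> ('a, 'k) ext_state) set" where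
  "tilde_Omega M U f g h m = codist_sum U (codist_lift U (Omega M f g h m)) (L_codist U g h m)"

end

theory Submission
  imports Defs
begin

text \<open>For a covector field \<open>\<omega>\<close> on \<open>M\<close> and \<open>\<lambda> = L\<^sub>g h\<close> one has
  \<open>L\<^sub>G [\<omega>, 0] = w \<lambda> [L\<^sub>g\<^sub>/\<^sub>\<lambda> \<omega>, 0] + (\<omega> g / \<lambda>) L\<^sub>G dh\<close>, so that, modulo \<open>L\<^sub>G dh\<close> and the invertible
  function \<open>w \<lambda>\<close>, deriving along \<open>G\<close> is deriving along \<open>g/\<lambda>\<close>. Since \<open>L\<^sub>G h = w \<lambda>\<close> and
  \<open>[\<phi>\<^sub>i, G] = w \<lambda> \<phi>\<^sub>i\<^sub>+\<^sub>1\<close> on the extended space, the functions \<open>A\<^sub>i\<^sub>j = L\<^sub>\<phi>\<^sub>i L\<^sub>G\<^sup>j h\<close> satisfy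
  \<open>w \<lambda> A\<^sub>i\<^sub>+\<^sub>1\<^sub>,\<^sub>j = A\<^sub>i\<^sub>,\<^sub>j\<^sub>+\<^sub>1 - L\<^sub>G A\<^sub>i\<^sub>,\<^sub>j\<close>. Differentiating this identity shows that \<open>d A\<^sub>i\<^sub>j\<close> lies in the
  codistribution of index \<open>i + j + 1\<close> on either side of the claim. The case \<open>j = 0\<close> yields the extra
  generators \<open>L\<^sub>\<phi>\<^sub>m dh\<close> of \<open>Omega\<close>, and the case \<open>i = 0\<close> yields \<open>L\<^sub>F L\<^sub>G\<^sup>j dh\<close>.\<close>

section \<open>Calculus of smooth maps\<close>

lemma has_derivative_cong_open:
  assumes "open U" "x \<in> U" "\<And>y. y \<in> U \<Longrightarrow> f y = g y"
  shows "(f has_derivative D) (at x) \<longleftrightarrow> (g has_derivative D) (at x)"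
  using has_derivative_transform_within_open[OF _ assms(1,2), of f D UNIV g]
    has_derivative_transform_within_open[OF _ assms(1,2), of g D UNIV f] assms(3)
  by auto

lemma frechet_derivative_cong_open:
  assumes "open U" "x \<in> U" "\<And>y. y \<in> U \<Longrightarrow> f y = g y"
  shows "frechet_derivative f (at x) = frechet_derivative g (at x)"
  using has_derivative_cong_open[OF assms] by (simp add: frechet_derivative_def)

lemma k_times_cont_diff_on_cong:
  assumes "open U" "\<And>x. x \<in> U \<Longrightarrow> f x = g x"
  shows "k_times_cont_diff_on k f U \<longleftrightarrow> k_times_cont_diff_on k g U"
  using assms(2)
proof (induction k arbitrary: f g)
  case 0
  then show ?case by (simp cong: continuous_on_cong)
next
  case (Suc k)
  have "f differentiable at x \<longleftrightarrow> g differentiable at x" if "x \<in> U" for x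
    using has_derivative_cong_open[OF assms(1) that Suc.prems] by (simp add: differentiable_def)
  moreover have "k_times_cont_diff_on k (\<lambda>x. frechet_derivative f (at x) v) U \<longleftrightarrow>
      k_times_cont_diff_on k (\<lambda>x. frechet_derivative g (at x) v) U" for v
    by (intro Suc.IH) (simp add: frechet_derivative_cong_open[OF assms(1) _ Suc.prems])
  ultimately show ?case by simp
qed

lemma k_times_cont_diff_on_Suc_imp:
  "k_times_cont_diff_on (Suc k) f U \<Longrightarrow> k_times_cont_diff_on k f U"
proof (induction k arbitrary: f)
  case 0
  then show ?case
    by (simp add: continuous_at_imp_continuous_on differentiable_imp_continuous_within)
next
  case (Suc k)
  then show ?case by (metis k_times_cont_diff_on.simps(2))
qed

text \<open>Derivatives are unique, so a known derivative \<open>f'\<close> may replace the chosen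
  \<open>frechet_derivative\<close> on an open set. The inductive closure rules below use this
  form.\<close>

lemma k_times_cont_diff_on_SucI:
  assumes "open U" "\<And>x. x \<in> U \<Longrightarrow> (f has_derivative f' x) (at x)"
    and "\<And>v. k_times_cont_diff_on k (\<lambda>x. f' x v) U"
  shows "k_times_cont_diff_on (Suc k) f U"
proof -
  have "k_times_cont_diff_on k (\<lambda>x. frechet_derivative f (at x) v) U \<longleftrightarrow>
      k_times_cont_diff_on k (\<lambda>x. f' x v) U" for v
    using assms(2) by (intro k_times_cont_diff_on_cong[OF assms(1)])
       (simp add: frechet_derivative_at[OF assms(2), symmetric])
  with assms(3) have "k_times_cont_diff_on k (\<lambda>x. frechet_derivative f (at x) v) U" for v
    by simp
  then show ?thesis
    using assms(2) by (auto simp: differentiable_def)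
qed

lemma k_times_cont_diff_on_derivative:
  assumes "k_times_cont_diff_on (Suc k) f U" "x \<in> U"
  shows "(f has_derivative frechet_derivative f (at x)) (at x)"
  using assms by (simp add: frechet_derivative_works)

lemma k_times_cont_diff_on_const:
  assumes "open U"
  shows "k_times_cont_diff_on k (\<lambda>x. c) U"
proof (induction k arbitrary: c)
  case (Suc k)
  show ?case
    by (rule k_times_cont_diff_on_SucI[OF assms, where f' = "\<lambda>x v. 0"]) (auto intro: Suc)
qed simp

lemma k_times_cont_diff_on_add:
  assumes "open U" "k_times_cont_diff_on k f U" "k_times_cont_diff_on k g U"
  shows "k_times_cont_diff_on k (\<lambda>x. f x + g x) U"
  using assms(2,3)
proof (induction k arbitrary: f g)
  case 0
  then show ?case by (simp add: continuous_on_add)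
next
  case (Suc k)
  show ?case
    by (rule k_times_cont_diff_on_SucI[OF assms(1)],
        rule has_derivative_add[OF Suc.prems[THEN k_times_cont_diff_on_derivative]])
       (use Suc in auto)
qed

lemma k_times_cont_diff_on_linear:
  assumes "open U" "bounded_linear L" "k_times_cont_diff_on k f U"
  shows "k_times_cont_diff_on k (\<lambda>x. L (f x)) U"
  using assms(3)
proof (induction k arbitrary: f)
  case 0
  then show ?case by (simp add: assms(2) bounded_linear.continuous_on)
next
  case (Suc k)
  show ?case
    by (rule k_times_cont_diff_on_SucI[OF assms(1)],
        rule bounded_linear.has_derivative[OF assms(2)
          k_times_cont_diff_on_derivative[OF Suc.prems]])
       (use Suc in auto)
qed

text \<open>With a linear inner map the derivative \<open>f' (L x) (L v)\<close> has the same shape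
  as the composition, so the induction closes. Applied to \<open>fst\<close>, the rule transports
  smoothness from \<open>M\<close> to the extended space.\<close>

lemma k_times_cont_diff_on_compose_linear:
  assumes "open U" "bounded_linear L" "\<And>x. x \<in> U \<Longrightarrow> L x \<in> V" "k_times_cont_diff_on k f V"
  shows "k_times_cont_diff_on k (\<lambda>x. f (L x)) U"
  using assms(4)
proof (induction k arbitrary: f)
  case 0
  then show ?case
    using continuous_on_compose2[OF _ linear_continuous_on[OF assms(2)], of V f U] assms(3) by auto
next
  case (Suc k)
  show ?case
  proof (rule k_times_cont_diff_on_SucI[OF assms(1)])
    fix x assume "x \<in> U"
    then show "((\<lambda>x. f (L x)) has_derivative
                 (\<lambda>v. frechet_derivative f (at (L x)) (L v))) (at x)"
      using has_derivative_compose[OF bounded_linear_imp_has_derivative[OF assms(2)]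
          k_times_cont_diff_on_derivative[OF Suc.prems assms(3)]] by simp
  next
    fix v
    show "k_times_cont_diff_on k (\<lambda>x. frechet_derivative f (at (L x)) (L v)) U"
      using Suc.prems by (intro Suc.IH) simp
  qed
qed

text \<open>One product rule for multiplication, scaling and inner product. Each summand of the
  derivative pairs an original factor with a derivative, so the original factors are also needed at
  order \<open>k\<close>.\<close>

lemma k_times_cont_diff_on_bilinear:
  assumes "open U" "bounded_bilinear B" "k_times_cont_diff_on k f U" "k_times_cont_diff_on k g U"
  shows "k_times_cont_diff_on k (\<lambda>x. B (f x) (g x)) U"
  using assms(3,4)
proof (induction k arbitrary: f g)
  case 0
  then show ?case by (simp add: assms(2) bounded_bilinear.continuous_on)
next
  case (Suc k)
  show ?case
  proof (rule k_times_cont_diff_on_SucI[OF assms(1)])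
    fix x assume "x \<in> U"
    then show "((\<lambda>x. B (f x) (g x)) has_derivative
        (\<lambda>v. B (f x) (frechet_derivative g (at x) v) + B (frechet_derivative f (at x) v) (g x))) (at x)"
      by (intro bounded_bilinear.FDERIV[OF assms(2)] Suc.prems[THEN k_times_cont_diff_on_derivative])
  next
    fix v
    show "k_times_cont_diff_on k
        (\<lambda>x. B (f x) (frechet_derivative g (at x) v) + B (frechet_derivative f (at x) v) (g x)) U"
      using Suc.prems Suc.prems[THEN k_times_cont_diff_on_Suc_imp]
      by (intro k_times_cont_diff_on_add assms(1) Suc.IH) auto
  qed
qed

text \<open>The derivative of \<open>1/f\<close> is a product containing \<open>1/f\<close> itself,
  whose regularity of order \<open>k\<close> is the induction hypothesis.\<close>

lemma k_times_cont_diff_on_inverse: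
  fixes f :: "'a::real_normed_vector \<Rightarrow> real"
  assumes "open U" "\<And>x. x \<in> U \<Longrightarrow> f x \<noteq> 0" "k_times_cont_diff_on k f U"
  shows "k_times_cont_diff_on k (\<lambda>x. inverse (f x)) U"
  using assms(3)
proof (induction k)
  case 0
  then show ?case using assms(2) by (simp add: continuous_on_inverse)
next
  case (Suc k)
  show ?case
  proof (rule k_times_cont_diff_on_SucI[OF assms(1)])
    fix x assume "x \<in> U"
    then show "((\<lambda>x. inverse (f x)) has_derivative
        (\<lambda>v. - (inverse (f x) * frechet_derivative f (at x) v * inverse (f x)))) (at x)"
      by (intro Deriv.has_derivative_inverse k_times_cont_diff_on_derivative[OF Suc.prems] assms(2))
  next
    fix v
    have "k_times_cont_diff_on k (\<lambda>x. inverse (f x)) U"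
      using Suc.IH k_times_cont_diff_on_Suc_imp[OF Suc.prems] .
    then show "k_times_cont_diff_on k
        (\<lambda>x. - (inverse (f x) * frechet_derivative f (at x) v * inverse (f x))) U"
      using Suc.prems
      by (intro k_times_cont_diff_on_linear[of U uminus] bounded_linear_minus bounded_linear_ident
          k_times_cont_diff_on_bilinear[of U "(*)"] bounded_bilinear_mult assms(1)) auto
  qed
qed

lemma smooth_on_cong:
  assumes "open U" "\<And>x. x \<in> U \<Longrightarrow> f x = g x"
  shows "smooth_on U f \<longleftrightarrow> smooth_on U g"
  using k_times_cont_diff_on_cong[OF assms] by (simp add: smooth_on_def)

lemma smooth_on_const: "open U \<Longrightarrow> smooth_on U (\<lambda>x. c)"
  by (simp add: smooth_on_def k_times_cont_diff_on_const)

lemma smooth_on_add: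
  "open U \<Longrightarrow> smooth_on U f \<Longrightarrow> smooth_on U g \<Longrightarrow> smooth_on U (\<lambda>x. f x + g x)"
  by (simp add: smooth_on_def k_times_cont_diff_on_add)

lemma smooth_on_sum:
  assumes "open U" "\<And>i. i \<in> I \<Longrightarrow> smooth_on U (f i)"
  shows "smooth_on U (\<lambda>x. \<Sum>i\<in>I. f i x)"
  using assms(2)
  by (induction I rule: infinite_finite_induct)
     (simp_all add: smooth_on_const smooth_on_add assms(1))

lemma smooth_on_linear:
  "open U \<Longrightarrow> bounded_linear L \<Longrightarrow> smooth_on U f \<Longrightarrow> smooth_on U (\<lambda>x. L (f x))"
  by (simp add: smooth_on_def k_times_cont_diff_on_linear)

lemma smooth_on_compose_linear:
  assumes "open U" "bounded_linear L" "\<And>x. x \<in> U \<Longrightarrow> L x \<in> V" "smooth_on V f"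
  shows "smooth_on U (\<lambda>x. f (L x))"
  using assms(4) k_times_cont_diff_on_compose_linear[OF assms(1-3)] unfolding smooth_on_def by blast

lemma smooth_on_bilinear:
  "open U \<Longrightarrow> bounded_bilinear B \<Longrightarrow> smooth_on U f \<Longrightarrow> smooth_on U g \<Longrightarrow>
    smooth_on U (\<lambda>x. B (f x) (g x))"
  by (simp add: smooth_on_def k_times_cont_diff_on_bilinear)

lemmas smooth_on_scaleR = smooth_on_bilinear[OF _ bounded_bilinear_scaleR]
  and smooth_on_mult = smooth_on_bilinear[OF _ bounded_bilinear_mult]
  and smooth_on_inner = smooth_on_bilinear[OF _ bounded_bilinear_inner]

lemma smooth_on_diff:
  assumes "open U" "smooth_on U f" "smooth_on U g"
  shows "smooth_on U (\<lambda>x. f x - g x)"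
  using smooth_on_add[OF assms(1,2)
      smooth_on_linear[OF assms(1) bounded_linear_minus[OF bounded_linear_ident] assms(3)]]
  by simp

lemma smooth_on_inverse:
  fixes f :: "'a::real_normed_vector \<Rightarrow> real"
  assumes "open U" "\<And>x. x \<in> U \<Longrightarrow> f x \<noteq> 0" "smooth_on U f"
  shows "smooth_on U (\<lambda>x. inverse (f x))"
  using assms k_times_cont_diff_on_inverse[OF assms(1,2)] by (simp add: smooth_on_def)

lemma smooth_on_bounded_linear:
  assumes "open U" "bounded_linear L"
  shows "smooth_on U L"
proof -
  have "k_times_cont_diff_on k L U" for k
  proof (cases k)
    case 0
    then show ?thesis by (simp add: linear_continuous_on assms(2))
  next
    case (Suc n)
    show ?thesis
      unfolding Suc
      by (rule k_times_cont_diff_on_SucI[OF assms(1)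
            bounded_linear_imp_has_derivative[OF assms(2)]])
         (rule k_times_cont_diff_on_const[OF assms(1)])
  qed
  then show ?thesis by (simp add: smooth_on_def)
qed

lemma smooth_on_Pair:
  assumes "open U" "smooth_on U f" "smooth_on U g"
  shows "smooth_on U (\<lambda>x. (f x, g x))"
proof -
  have "smooth_on U (\<lambda>x. (f x, 0) + (0, g x))"
    by (intro smooth_on_add assms(1)
        smooth_on_linear[OF assms(1) bounded_linear_Pair[OF bounded_linear_ident bounded_linear_zero] assms(2)]
        smooth_on_linear[OF assms(1) bounded_linear_Pair[OF bounded_linear_zero bounded_linear_ident] assms(3)])
  then show ?thesis by simp
qed

lemma smooth_on_has_derivative:
  "smooth_on U f \<Longrightarrow> x \<in> U \<Longrightarrow> (f has_derivative frechet_derivative f (at x)) (at x)"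
  using k_times_cont_diff_on_derivative smooth_on_def by blast

lemma smooth_on_linear_derivative:
  "smooth_on U f \<Longrightarrow> x \<in> U \<Longrightarrow> linear (frechet_derivative f (at x))"
  using smooth_on_has_derivative has_derivative_linear by blast

lemma smooth_on_directional:
  "smooth_on U f \<Longrightarrow> smooth_on U (\<lambda>x. frechet_derivative f (at x) v)"
  by (metis k_times_cont_diff_on.simps(2) smooth_on_def)

text \<open>\<open>smooth_on\<close> speaks of derivatives in fixed directions; a direction that
  varies with the point is expanded in the standard basis by linearity.\<close>

lemma smooth_on_derivative_apply:
  fixes f :: "'a::euclidean_space \<Rightarrow> 'b::real_normed_vector"
  assumes "open U" "smooth_on U f" "smooth_on U \<theta>"
  shows "smooth_on U (\<lambda>x. frechet_derivative f (at x) (\<theta> x))"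
proof -
  have "frechet_derivative f (at x) (\<theta> x) =
      (\<Sum>b\<in>Basis. (\<theta> x \<bullet> b) *\<^sub>R frechet_derivative f (at x) b)" if "x \<in> U" for x
  proof -
    interpret linear "frechet_derivative f (at x)"
      using smooth_on_linear_derivative[OF assms(2) that] .
    show ?thesis
      by (subst euclidean_representation[of "\<theta> x", symmetric]) (simp only: sum scaleR)
  qed
  then have eq: "smooth_on U (\<lambda>x. frechet_derivative f (at x) (\<theta> x)) \<longleftrightarrow>
      smooth_on U (\<lambda>x. \<Sum>b\<in>Basis. (\<theta> x \<bullet> b) *\<^sub>R frechet_derivative f (at x) b)"
    by (rule smooth_on_cong[OF assms(1)])
  show ?thesis
    unfolding eq
    by (intro smooth_on_sum smooth_on_scaleR smooth_on_inner smooth_on_directional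
        smooth_on_const assms)
qed

section \<open>Lie derivatives\<close>

text \<open>Linearity turns the basis sum back into an application of the derivative. Together with
  \<open>lie_cov_inner\<close>, this lets identities between covectors be checked by pairing with an
  arbitrary vector.\<close>

lemma differential_inner:
  assumes "linear (frechet_derivative \<psi> (at x))"
  shows "differential \<psi> x \<bullet> v = frechet_derivative \<psi> (at x) v"
proof -
  interpret linear "frechet_derivative \<psi> (at x)" by fact
  have "frechet_derivative \<psi> (at x) v = frechet_derivative \<psi> (at x) (\<Sum>b\<in>Basis. (v \<bullet> b) *\<^sub>R b)"
    by (simp add: euclidean_representation)
  also have "\<dots> = (\<Sum>b\<in>Basis. (v \<bullet> b) * frechet_derivative \<psi> (at x) b)"
    by (simp only: sum scaleR real_scaleR_def)
  finally show ?thesis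
    by (simp add: differential_def inner_sum_left inner_commute[of v] mult.commute)
qed

lemma lie_cov_inner:
  assumes "linear (frechet_derivative \<theta> (at x))"
  shows "lie_cov \<theta> \<omega> x \<bullet> v =
    frechet_derivative \<omega> (at x) (\<theta> x) \<bullet> v + \<omega> x \<bullet> frechet_derivative \<theta> (at x) v"
proof -
  interpret linear "frechet_derivative \<theta> (at x)" by fact
  have "frechet_derivative \<theta> (at x) v = frechet_derivative \<theta> (at x) (\<Sum>b\<in>Basis. (v \<bullet> b) *\<^sub>R b)"
    by (simp add: euclidean_representation)
  also have "\<dots> = (\<Sum>b\<in>Basis. (v \<bullet> b) *\<^sub>R frechet_derivative \<theta> (at x) b)"
    by (simp only: sum scaleR)
  finally show ?thesis
    by (simp add: lie_cov_def inner_sum_left inner_sum_right inner_add_left inner_commute[of v] mult.commute)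
qed

lemma smooth_on_differential:
  "open U \<Longrightarrow> smooth_on U \<psi> \<Longrightarrow> smooth_on U (differential \<psi>)"
  unfolding differential_def
  by (intro smooth_on_sum smooth_on_scaleR smooth_on_const smooth_on_directional)

lemma smooth_on_lie_fun:
  "open U \<Longrightarrow> smooth_on U \<theta> \<Longrightarrow> smooth_on U \<psi> \<Longrightarrow> smooth_on U (lie_fun \<theta> \<psi>)"
  unfolding lie_fun_def by (rule smooth_on_derivative_apply)

lemma smooth_on_lie_cov:
  "open U \<Longrightarrow> smooth_on U \<theta> \<Longrightarrow> smooth_on U \<omega> \<Longrightarrow> smooth_on U (lie_cov \<theta> \<omega>)"
  unfolding lie_cov_def
  by (intro smooth_on_sum smooth_on_scaleR smooth_on_const smooth_on_directional smooth_on_add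
      smooth_on_derivative_apply smooth_on_inner)

lemma smooth_on_lie_bracket:
  "open U \<Longrightarrow> smooth_on U a \<Longrightarrow> smooth_on U b \<Longrightarrow> smooth_on U (lie_bracket a b)"
  unfolding lie_bracket_def by (intro smooth_on_diff smooth_on_derivative_apply)

section \<open>Second derivatives and commutation rules\<close>

text \<open>The mean value theorem is applied twice: along \<open>u\<close> to the difference of
  \<open>\<psi>\<close> on two parallel segments, then along \<open>v\<close> to the derivative in
  direction \<open>u\<close>.\<close>

lemma second_difference_mvt:
  fixes \<psi> :: "'a::real_normed_vector \<Rightarrow> real"
  assumes \<psi>: "smooth_on U \<psi>" and s: "s > 0"
    and sub: "\<And>a b. 0 \<le> a \<Longrightarrow> a \<le> s \<Longrightarrow> 0 \<le> b \<Longrightarrow> b \<le> s \<Longrightarrow> x + a *\<^sub>R u + b *\<^sub>R v \<in> U"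
  obtains a b where "0 \<le> a" "a \<le> s" "0 \<le> b" "b \<le> s"
    "\<psi> (x + s *\<^sub>R u + s *\<^sub>R v) - \<psi> (x + s *\<^sub>R u) - \<psi> (x + s *\<^sub>R v) + \<psi> x =
     s * s * frechet_derivative (\<lambda>y. frechet_derivative \<psi> (at y) u) (at (x + a *\<^sub>R u + b *\<^sub>R v)) v"
proof -
  define D where "D y = frechet_derivative \<psi> (at y) u" for y
  have D: "smooth_on U D"
    unfolding D_def by (rule smooth_on_directional[OF \<psi>])
  have line: "DERIV (\<lambda>t. F (y + t *\<^sub>R z)) t :> frechet_derivative F (at (y + t *\<^sub>R z)) z"
    if "smooth_on U F" "y + t *\<^sub>R z \<in> U" for F :: "'a \<Rightarrow> real" and y z t
  proof -
    interpret linear "frechet_derivative F (at (y + t *\<^sub>R z))"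
      using smooth_on_linear_derivative[OF that] .
    have "((\<lambda>t. y + t *\<^sub>R z) has_derivative (\<lambda>h. h *\<^sub>R z)) (at t)"
      by (auto intro!: derivative_eq_intros)
    from has_derivative_compose[OF this smooth_on_has_derivative[OF that]]
    show ?thesis
      by (rule has_derivative_imp_has_field_derivative) (simp add: scaleR)
  qed
  have "DERIV (\<lambda>t. \<psi> (x + s *\<^sub>R v + t *\<^sub>R u) - \<psi> (x + t *\<^sub>R u)) t :>
      D (x + s *\<^sub>R v + t *\<^sub>R u) - D (x + t *\<^sub>R u)" if "0 \<le> t" "t \<le> s" for t
    unfolding D_def
    using sub[of t s] sub[of t 0] that s
    by (intro DERIV_diff line \<psi>) (auto simp: algebra_simps)
  from MVT2[OF s this] obtain a where a: "0 < a" "a < s"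
    and 1: "\<psi> (x + s *\<^sub>R v + s *\<^sub>R u) - \<psi> (x + s *\<^sub>R u) - (\<psi> (x + s *\<^sub>R v) - \<psi> x) =
       s * (D (x + s *\<^sub>R v + a *\<^sub>R u) - D (x + a *\<^sub>R u))"
    by auto
  have "DERIV (\<lambda>t. D (x + a *\<^sub>R u + t *\<^sub>R v)) t :>
      frechet_derivative D (at (x + a *\<^sub>R u + t *\<^sub>R v)) v" if "0 \<le> t" "t \<le> s" for t
    using sub[of a t] that a by (intro line D) auto
  from MVT2[OF s this] obtain b where b: "0 < b" "b < s"
    and 2: "D (x + a *\<^sub>R u + s *\<^sub>R v) - D (x + a *\<^sub>R u) =
       s * frechet_derivative D (at (x + a *\<^sub>R u + b *\<^sub>R v)) v"
    by auto
  have "\<psi> (x + s *\<^sub>R u + s *\<^sub>R v) - \<psi> (x + s *\<^sub>R u) - \<psi> (x + s *\<^sub>R v) + \<psi> x =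
     s * s * frechet_derivative D (at (x + a *\<^sub>R u + b *\<^sub>R v)) v"
    using 1 2 by (simp add: algebra_simps)
  then show ?thesis
    using that[of a b] a b by (simp add: D_def[abs_def])
qed

text \<open>The second difference over a small parallelogram is symmetric in \<open>u\<close> and
  \<open>v\<close> and equals \<open>s * s\<close> times either mixed derivative at some nearby
  point. Continuity of both derivatives at \<open>x\<close> then forces equality.\<close>

lemma smooth_on_second_derivative_commute:
  fixes \<psi> :: "'a::real_normed_vector \<Rightarrow> real"
  assumes "open U" "x \<in> U" "smooth_on U \<psi>"
  shows "frechet_derivative (\<lambda>y. frechet_derivative \<psi> (at y) u) (at x) v =
         frechet_derivative (\<lambda>y. frechet_derivative \<psi> (at y) v) (at x) u"
proof -
  define P where "P y = frechet_derivative (\<lambda>y. frechet_derivative \<psi> (at y) u) (at y) v" for y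
  define Q where "Q y = frechet_derivative (\<lambda>y. frechet_derivative \<psi> (at y) v) (at y) u" for y
  have cont: "continuous (at x) P" "continuous (at x) Q"
    unfolding P_def Q_def
    by (intro has_derivative_continuous[OF smooth_on_has_derivative[OF _ assms(2)]]
        smooth_on_directional assms(3))+
  have "\<bar>P x - Q x\<bar> \<le> e" if e: "e > 0" for e
  proof -
    obtain d0 where d0: "d0 > 0" "ball x d0 \<subseteq> U"
      using assms(1,2) openE by blast
    obtain d1 where d1: "d1 > 0" "\<And>y. dist y x < d1 \<Longrightarrow> dist (P y) (P x) < e / 2"
      using cont(1) e unfolding continuous_at_eps_delta by (auto dest!: spec[of _ "e / 2"])
    obtain d2 where d2: "d2 > 0" "\<And>y. dist y x < d2 \<Longrightarrow> dist (Q y) (Q x) < e / 2"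
      using cont(2) e unfolding continuous_at_eps_delta by (auto dest!: spec[of _ "e / 2"])
    define d where "d = min d0 (min d1 d2)"
    \<comment> \<open>This size keeps the parallelogram within distance \<open>d\<close> of
      \<open>x\<close>; the summand 1 keeps the denominator positive when \<open>u\<close> and
      \<open>v\<close> vanish.\<close>
    define s where "s = d / (norm u + norm v + 1)"
    have "d > 0" using d0 d1 d2 by (simp add: d_def)
    have n: "norm u + norm v + 1 > 0"
      using norm_ge_zero[of u] norm_ge_zero[of v] by linarith
    have s: "s > 0" using \<open>d > 0\<close> n by (simp add: s_def)
    have near: "norm (a *\<^sub>R u + b *\<^sub>R v) < d" if "0 \<le> a" "a \<le> s" "0 \<le> b" "b \<le> s" for a b
    proof -
      have "norm (a *\<^sub>R u + b *\<^sub>R v) \<le> a * norm u + b * norm v"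
        using norm_triangle_ineq[of "a *\<^sub>R u" "b *\<^sub>R v"] that by simp
      also have "\<dots> \<le> s * norm u + s * norm v"
        using that by (intro add_mono mult_right_mono) auto
      also have "\<dots> < s * (norm u + norm v + 1)"
        using s by (simp add: algebra_simps)
      also have "\<dots> = d" using n by (simp add: s_def)
      finally show ?thesis .
    qed
    have near1: "dist (x + a *\<^sub>R u + b *\<^sub>R v) x < d" "dist (x + b *\<^sub>R v + a *\<^sub>R u) x < d"
      if "0 \<le> a" "a \<le> s" "0 \<le> b" "b \<le> s" for a b
      using near[OF that] by (simp_all add: dist_norm algebra_simps)
    have inU: "x + a *\<^sub>R u + b *\<^sub>R v \<in> U" "x + b *\<^sub>R v + a *\<^sub>R u \<in> U"
      if "0 \<le> a" "a \<le> s" "0 \<le> b" "b \<le> s" for a b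
      using near1[OF that] d0(2) by (auto simp: d_def dist_commute subset_iff)
    obtain a b where ab: "0 \<le> a" "a \<le> s" "0 \<le> b" "b \<le> s" and eP:
      "\<psi> (x + s *\<^sub>R u + s *\<^sub>R v) - \<psi> (x + s *\<^sub>R u) - \<psi> (x + s *\<^sub>R v) + \<psi> x =
       s * s * P (x + a *\<^sub>R u + b *\<^sub>R v)"
      unfolding P_def by (rule second_difference_mvt[OF assms(3) s inU(1)])
    obtain b' a' where ab': "0 \<le> b'" "b' \<le> s" "0 \<le> a'" "a' \<le> s" and eQ:
      "\<psi> (x + s *\<^sub>R v + s *\<^sub>R u) - \<psi> (x + s *\<^sub>R v) - \<psi> (x + s *\<^sub>R u) + \<psi> x =
       s * s * Q (x + b' *\<^sub>R v + a' *\<^sub>R u)"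
      unfolding Q_def by (rule second_difference_mvt[OF assms(3) s inU(2)])
    have "s * s * P (x + a *\<^sub>R u + b *\<^sub>R v) = s * s * Q (x + b' *\<^sub>R v + a' *\<^sub>R u)"
      using eP eQ by (simp add: algebra_simps)
    then have "P (x + a *\<^sub>R u + b *\<^sub>R v) = Q (x + b' *\<^sub>R v + a' *\<^sub>R u)"
      using s by simp
    moreover have "dist (P (x + a *\<^sub>R u + b *\<^sub>R v)) (P x) < e / 2"
      using near1(1)[OF ab] by (intro d1) (simp add: d_def)
    moreover have "dist (Q (x + b' *\<^sub>R v + a' *\<^sub>R u)) (Q x) < e / 2"
      using near1(2)[OF ab'(3,4,1,2)] by (intro d2) (simp add: d_def)
    ultimately show ?thesis
      unfolding dist_real_def by linarith
  qed
  then have "\<bar>P x - Q x\<bar> \<le> 0"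
    by (rule field_le_epsilon[of _ 0, simplified])
  then show ?thesis by (simp add: P_def Q_def)
qed

lemma frechet_derivative_inner_const:
  assumes "smooth_on U \<omega>" "x \<in> U"
  shows "frechet_derivative (\<lambda>y. \<omega> y \<bullet> v) (at x) u = frechet_derivative \<omega> (at x) u \<bullet> v"
proof -
  have "((\<lambda>y. \<omega> y \<bullet> v) has_derivative (\<lambda>u. frechet_derivative \<omega> (at x) u \<bullet> v)) (at x)"
    by (intro has_derivative_inner_left smooth_on_has_derivative[OF assms])
  then show ?thesis by (simp add: frechet_derivative_at[symmetric])
qed

text \<open>This is the symmetry of the Hessian of \<open>\<psi>\<close>, read off from the
  commuting mixed derivatives.\<close>

lemma differential_derivative_symmetric:
  assumes "open U" "x \<in> U" "smooth_on U \<psi>"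
  shows "frechet_derivative (differential \<psi>) (at x) u \<bullet> v =
         frechet_derivative (differential \<psi>) (at x) v \<bullet> u"
proof -
  have "frechet_derivative (differential \<psi>) (at x) u \<bullet> v =
      frechet_derivative (\<lambda>y. frechet_derivative \<psi> (at y) v) (at x) u" for u v
  proof -
    have "frechet_derivative (\<lambda>y. frechet_derivative \<psi> (at y) v) (at x) =
        frechet_derivative (\<lambda>y. differential \<psi> y \<bullet> v) (at x)"
      using assms
      by (intro frechet_derivative_cong_open[of U])
         (auto simp: differential_inner smooth_on_linear_derivative)
    then show ?thesis
      using frechet_derivative_inner_const[OF smooth_on_differential[OF assms(1,3)] assms(2)]
      by simp
  qed
  then show ?thesis
    using smooth_on_second_derivative_commute[OF assms] by simp
qed

lemma lie_fun_eq_inner: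
  "smooth_on U \<psi> \<Longrightarrow> x \<in> U \<Longrightarrow> lie_fun \<theta> \<psi> x = differential \<psi> x \<bullet> \<theta> x"
  by (simp add: lie_fun_def differential_inner smooth_on_linear_derivative)

lemma frechet_derivative_lie_fun:
  assumes "open U" "x \<in> U" "smooth_on U \<theta>" "smooth_on U \<psi>"
  shows "frechet_derivative (lie_fun \<theta> \<psi>) (at x) v =
    differential \<psi> x \<bullet> frechet_derivative \<theta> (at x) v +
    frechet_derivative (differential \<psi>) (at x) v \<bullet> \<theta> x"
proof -
  have "frechet_derivative (lie_fun \<theta> \<psi>) (at x) =
      frechet_derivative (\<lambda>y. differential \<psi> y \<bullet> \<theta> y) (at x)"
    using assms by (intro frechet_derivative_cong_open[of U] lie_fun_eq_inner)
  moreover have "((\<lambda>y. differential \<psi> y \<bullet> \<theta> y) has_derivative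
      (\<lambda>v. differential \<psi> x \<bullet> frechet_derivative \<theta> (at x) v +
         frechet_derivative (differential \<psi>) (at x) v \<bullet> \<theta> x)) (at x)"
    by (intro has_derivative_inner smooth_on_has_derivative[of U] smooth_on_differential assms)
  ultimately show ?thesis by (simp add: frechet_derivative_at[symmetric])
qed

text \<open>Paired with \<open>v\<close>, both sides are a Hessian term plus the differential of
  \<open>\<psi>\<close> applied to the derivative of \<open>\<theta>\<close> along \<open>v\<close>.
  The Hessian terms differ by an exchange of arguments.\<close>

lemma lie_cov_differential:
  assumes "open U" "x \<in> U" "smooth_on U \<theta>" "smooth_on U \<psi>"
  shows "lie_cov \<theta> (differential \<psi>) x = differential (lie_fun \<theta> \<psi>) x"
proof -
  have "lie_cov \<theta> (differential \<psi>) x \<bullet> v = differential (lie_fun \<theta> \<psi>) x \<bullet> v" for v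
    using differential_derivative_symmetric[OF assms(1,2,4), of v "\<theta> x"] assms
    by (simp add: lie_cov_inner differential_inner smooth_on_linear_derivative[of U]
        smooth_on_lie_fun frechet_derivative_lie_fun)
  then show ?thesis by (meson vector_eq_rdot)
qed

text \<open>The second-order parts of the two iterated derivatives cancel by symmetry of the
  Hessian, and the first-order remainder is the bracket.\<close>

lemma lie_fun_lie_bracket:
  assumes "open U" "x \<in> U" "smooth_on U a" "smooth_on U b" "smooth_on U \<psi>"
  shows "lie_fun (lie_bracket a b) \<psi> x = lie_fun a (lie_fun b \<psi>) x - lie_fun b (lie_fun a \<psi>) x"
proof -
  have "lie_fun (lie_bracket a b) \<psi> x = differential \<psi> x \<bullet> lie_bracket a b x"
    using assms by (intro lie_fun_eq_inner)
  then show ?thesis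
    using differential_derivative_symmetric[OF assms(1,2,5), of "a x" "b x"] assms
    by (simp add: lie_fun_def[of _ "lie_fun _ _"] frechet_derivative_lie_fun lie_bracket_def
        inner_diff_right)
qed

lemma differential_mult:
  assumes "open U" "x \<in> U" "smooth_on U a" "smooth_on U b"
  shows "differential (\<lambda>y. a y * b y) x = a x *\<^sub>R differential b x + b x *\<^sub>R differential a x"
proof -
  have "((\<lambda>y. a y * b y) has_derivative
     (\<lambda>v. a x * frechet_derivative b (at x) v + frechet_derivative a (at x) v * b x)) (at x)"
    by (intro has_derivative_mult smooth_on_has_derivative[of U] assms)
  then have "frechet_derivative (\<lambda>y. a y * b y) (at x) =
      (\<lambda>v. a x * frechet_derivative b (at x) v + frechet_derivative a (at x) v * b x)"
    by (rule frechet_derivative_at[symmetric])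
  then show ?thesis
    by (simp add: differential_def scaleR_add_left sum.distrib scaleR_sum_right mult.commute)
qed

lemma differential_diff:
  assumes "x \<in> U" "smooth_on U a" "smooth_on U b"
  shows "differential (\<lambda>y. a y - b y) x = differential a x - differential b x"
proof -
  have "((\<lambda>y. a y - b y) has_derivative
     (\<lambda>v. frechet_derivative a (at x) v - frechet_derivative b (at x) v)) (at x)"
    by (intro has_derivative_diff smooth_on_has_derivative[of U] assms)
  then have "frechet_derivative (\<lambda>y. a y - b y) (at x) =
      (\<lambda>v. frechet_derivative a (at x) v - frechet_derivative b (at x) v)"
    by (rule frechet_derivative_at[symmetric])
  then show ?thesis
    by (simp add: differential_def scaleR_diff_left sum_subtractf)
qed

lemma differential_cong:
  assumes "open U" "x \<in> U" "\<And>y. y \<in> U \<Longrightarrow> a y = b y"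
  shows "differential a x = differential b x"
  by (simp add: differential_def frechet_derivative_cong_open[OF assms])

lemma lie_cov_cong:
  assumes "open U" "x \<in> U" "\<And>y. y \<in> U \<Longrightarrow> \<omega> y = \<eta> y"
  shows "lie_cov \<theta> \<omega> x = lie_cov \<theta> \<eta> x"
  by (simp add: lie_cov_def frechet_derivative_cong_open[OF assms] assms)

lemma lie_cov_cong_field:
  assumes "open U" "x \<in> U" "\<And>y. y \<in> U \<Longrightarrow> \<theta> y = \<zeta> y"
  shows "lie_cov \<theta> \<omega> x = lie_cov \<zeta> \<omega> x"
  by (simp add: lie_cov_def frechet_derivative_cong_open[OF assms] assms)

lemma frechet_derivative_scaleR:
  fixes c :: "'a::real_normed_vector \<Rightarrow> real"
  assumes "smooth_on U c" "smooth_on U \<omega>" "x \<in> U"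
  shows "frechet_derivative (\<lambda>y. c y *\<^sub>R \<omega> y) (at x) v =
    c x *\<^sub>R frechet_derivative \<omega> (at x) v + frechet_derivative c (at x) v *\<^sub>R \<omega> x"
proof -
  have "((\<lambda>y. c y *\<^sub>R \<omega> y) has_derivative (\<lambda>v. c x *\<^sub>R frechet_derivative \<omega> (at x) v +
      frechet_derivative c (at x) v *\<^sub>R \<omega> x)) (at x)"
    by (intro has_derivative_scaleR smooth_on_has_derivative[of U] assms)
  then show ?thesis by (simp add: frechet_derivative_at[symmetric])
qed

lemma lie_cov_scaleR:
  assumes "smooth_on U c" "smooth_on U \<omega>" "x \<in> U"
  shows "lie_cov \<theta> (\<lambda>y. c y *\<^sub>R \<omega> y) x = lie_fun \<theta> c x *\<^sub>R \<omega> x + c x *\<^sub>R lie_cov \<theta> \<omega> x"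
  by (simp add: lie_cov_def lie_fun_def frechet_derivative_scaleR[OF assms] scaleR_add_right
      scaleR_sum_right)

text \<open>Differentiating the factor \<open>c\<close> in the field yields the extra multiple of
  \<open>differential c\<close>. For \<open>c = L_g h\<close> it is this term that
  \<open>L_G dh\<close> absorbs later.\<close>

lemma lie_cov_scaleR_field:
  assumes "smooth_on U c" "smooth_on U \<theta>" "smooth_on U \<omega>" "x \<in> U"
  shows "lie_cov (\<lambda>y. c y *\<^sub>R \<theta> y) \<omega> x =
    c x *\<^sub>R lie_cov \<theta> \<omega> x + (\<omega> x \<bullet> \<theta> x) *\<^sub>R differential c x"
proof -
  interpret linear "frechet_derivative \<omega> (at x)"
    by (rule smooth_on_linear_derivative[OF assms(3,4)])
  show ?thesis
    by (simp add: lie_cov_def differential_def frechet_derivative_scaleR[OF assms(1,2,4)] scaleR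
        scaleR_add_right scaleR_add_left scaleR_sum_right inner_add_right sum.distrib mult.commute)
qed

lemma lie_cov_add:
  assumes "smooth_on U \<alpha>" "smooth_on U \<beta>" "x \<in> U"
  shows "lie_cov \<theta> (\<lambda>y. \<alpha> y + \<beta> y) x = lie_cov \<theta> \<alpha> x + lie_cov \<theta> \<beta> x"
proof -
  have "((\<lambda>y. \<alpha> y + \<beta> y) has_derivative
      (\<lambda>v. frechet_derivative \<alpha> (at x) v + frechet_derivative \<beta> (at x) v)) (at x)"
    by (intro has_derivative_add smooth_on_has_derivative[of U] assms)
  then show ?thesis
    by (simp add: lie_cov_def frechet_derivative_at[symmetric] inner_add_left scaleR_add_left
        sum.distrib)
qed

section \<open>Codistributions as modules\<close>

text \<open>Closure properties of a submodule of covector fields on \<open>U\<close>; the last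
  clause matches the convention that values outside \<open>U\<close> are free. Through
  \<open>codist_span_least\<close>, inclusions of spans in such sets reduce to generators.\<close>

definition codist_module :: "'a::euclidean_space set \<Rightarrow> ('a \<Rightarrow> 'a) set \<Rightarrow> bool" where
  "codist_module U W \<longleftrightarrow>
     (\<lambda>x. 0) \<in> W \<and>
     (\<forall>\<alpha>\<in>W. \<forall>\<beta>\<in>W. (\<lambda>x. \<alpha> x + \<beta> x) \<in> W) \<and>
     (\<forall>c. \<forall>\<alpha>\<in>W. smooth_on U c \<longrightarrow> (\<lambda>x. c x *\<^sub>R \<alpha> x) \<in> W) \<and>
     (\<forall>\<alpha>\<in>W. \<forall>\<beta>. (\<forall>x\<in>U. \<beta> x = \<alpha> x) \<longrightarrow> \<beta> \<in> W)"

lemma codist_module_cong: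
  "codist_module U W \<Longrightarrow> \<alpha> \<in> W \<Longrightarrow> (\<And>x. x \<in> U \<Longrightarrow> \<beta> x = \<alpha> x) \<Longrightarrow> \<beta> \<in> W"
  by (simp add: codist_module_def)

lemma codist_module_zero: "codist_module U W \<Longrightarrow> (\<lambda>x. 0) \<in> W"
  by (simp add: codist_module_def)

lemma codist_module_add:
  "codist_module U W \<Longrightarrow> \<alpha> \<in> W \<Longrightarrow> \<beta> \<in> W \<Longrightarrow> (\<lambda>x. \<alpha> x + \<beta> x) \<in> W"
  by (simp add: codist_module_def)

lemma codist_module_scaleR:
  "codist_module U W \<Longrightarrow> smooth_on U c \<Longrightarrow> \<alpha> \<in> W \<Longrightarrow> (\<lambda>x. c x *\<^sub>R \<alpha> x) \<in> W"
  by (simp add: codist_module_def)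

lemma codist_module_lincomb:
  assumes "codist_module U W" "\<alpha> \<in> W" "\<beta> \<in> W" "smooth_on U a" "smooth_on U b"
    and "\<And>x. x \<in> U \<Longrightarrow> \<omega> x = a x *\<^sub>R \<alpha> x + b x *\<^sub>R \<beta> x"
  shows "\<omega> \<in> W"
proof -
  have "(\<lambda>x. a x *\<^sub>R \<alpha> x + b x *\<^sub>R \<beta> x) \<in> W"
    by (intro codist_module_add[OF assms(1)] codist_module_scaleR[OF assms(1)] assms(2-5))
  then show ?thesis
    by (rule codist_module_cong[OF assms(1)]) (rule assms(6))
qed

lemma codist_module_sum:
  assumes "codist_module U W" "\<And>i. i \<in> I \<Longrightarrow> \<alpha> i \<in> W"
  shows "(\<lambda>x. \<Sum>i\<in>I. \<alpha> i x) \<in> W"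
  using assms(2)
proof (induction I rule: infinite_finite_induct)
  case (insert i I)
  then have "(\<lambda>x. \<alpha> i x + (\<Sum>i\<in>I. \<alpha> i x)) \<in> W"
    by (intro codist_module_add[OF assms(1)]) auto
  then show ?case using insert by simp
qed (simp_all add: codist_module_zero[OF assms(1)])

lemma codist_span_least:
  assumes "codist_module U W" "S \<subseteq> W"
  shows "codist_span U S \<subseteq> W"
proof
  fix \<omega> assume "\<omega> \<in> codist_span U S"
  then obtain T c where T: "T \<subseteq> S" "\<forall>\<eta>\<in>T. smooth_on U (c \<eta>)"
      "\<forall>x\<in>U. \<omega> x = (\<Sum>\<eta>\<in>T. c \<eta> x *\<^sub>R \<eta> x)"
    unfolding codist_span_def by blast
  have "(\<lambda>x. \<Sum>\<eta>\<in>T. c \<eta> x *\<^sub>R \<eta> x) \<in> W"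
    using T(1,2) assms(2) by (intro codist_module_sum[OF assms(1)] codist_module_scaleR[OF assms(1)])
      blast+
  then show "\<omega> \<in> W"
    by (rule codist_module_cong[OF assms(1) _ T(3)[rule_format]])
qed

lemma codist_span_superset:
  assumes "open U" "\<eta> \<in> S"
  shows "\<eta> \<in> codist_span U S"
  unfolding codist_span_def mem_Collect_eq
  by (rule exI[of _ "{\<eta>}"], rule exI[of _ "\<lambda>_ _. 1"])
     (use assms smooth_on_const[of U] in auto)

lemma codist_span_module:
  assumes "open U"
  shows "codist_module U (codist_span U S)"
  unfolding codist_module_def
proof (intro conjI ballI allI impI)
  show "(\<lambda>x. 0) \<in> codist_span U S"
    unfolding codist_span_def by (auto intro!: exI[of _ "{}"])
next
  fix \<alpha> \<beta> assume "\<alpha> \<in> codist_span U S" "\<beta> \<in> codist_span U S"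
  then obtain A a B b where
    A: "finite A" "A \<subseteq> S" "\<forall>\<eta>\<in>A. smooth_on U (a \<eta>)" "\<forall>x\<in>U. \<alpha> x = (\<Sum>\<eta>\<in>A. a \<eta> x *\<^sub>R \<eta> x)" and
    B: "finite B" "B \<subseteq> S" "\<forall>\<eta>\<in>B. smooth_on U (b \<eta>)" "\<forall>x\<in>U. \<beta> x = (\<Sum>\<eta>\<in>B. b \<eta> x *\<^sub>R \<eta> x)"
    unfolding codist_span_def by blast
  \<comment> \<open>Both coefficient families are extended by zero to the union of the generator
    sets, so a generator in both collects the two coefficients.\<close>
  define c where "c \<eta> x = (if \<eta> \<in> A then a \<eta> x else 0) + (if \<eta> \<in> B then b \<eta> x else 0)" for \<eta> x
  have "smooth_on U (c \<eta>)" for \<eta>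
    unfolding c_def using A(3) B(3) assms
    by (cases "\<eta> \<in> A"; cases "\<eta> \<in> B") (simp_all add: smooth_on_const smooth_on_add)
  moreover have "\<alpha> x + \<beta> x = (\<Sum>\<eta>\<in>A \<union> B. c \<eta> x *\<^sub>R \<eta> x)" if "x \<in> U" for x
  proof -
    have "\<alpha> x = (\<Sum>\<eta>\<in>A \<union> B. (if \<eta> \<in> A then a \<eta> x else 0) *\<^sub>R \<eta> x)"
      using A B(1) that by (auto intro!: sum.mono_neutral_cong_left)
    moreover have "\<beta> x = (\<Sum>\<eta>\<in>A \<union> B. (if \<eta> \<in> B then b \<eta> x else 0) *\<^sub>R \<eta> x)"
      using B A(1) that by (auto intro!: sum.mono_neutral_cong_left)
    ultimately show ?thesis
      by (simp add: c_def scaleR_add_left sum.distrib)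
  qed
  ultimately show "(\<lambda>x. \<alpha> x + \<beta> x) \<in> codist_span U S"
    unfolding codist_span_def mem_Collect_eq using A B
    by (intro exI[of _ "A \<union> B"] exI[of _ c]) auto
next
  fix c :: "'a \<Rightarrow> real" and \<alpha> assume "\<alpha> \<in> codist_span U S" and c: "smooth_on U c"
  then obtain A a where
    A: "finite A" "A \<subseteq> S" "\<forall>\<eta>\<in>A. smooth_on U (a \<eta>)" "\<forall>x\<in>U. \<alpha> x = (\<Sum>\<eta>\<in>A. a \<eta> x *\<^sub>R \<eta> x)"
    unfolding codist_span_def by blast
  then show "(\<lambda>x. c x *\<^sub>R \<alpha> x) \<in> codist_span U S"
    unfolding codist_span_def mem_Collect_eq using c assms
    by (intro exI[of _ A] exI[of _ "\<lambda>\<eta> x. c x * a \<eta> x"])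
       (auto simp: scaleR_sum_right intro: smooth_on_mult)
next
  fix \<alpha> \<beta> :: "'a \<Rightarrow> 'a"
  assume "\<alpha> \<in> codist_span U S" "\<forall>x\<in>U. \<beta> x = \<alpha> x"
  then show "\<beta> \<in> codist_span U S"
    unfolding codist_span_def by fastforce
qed

lemma smooth_codist_module:
  assumes "open U"
  shows "codist_module U {\<omega>. smooth_on U \<omega>}"
proof -
  have "smooth_on U \<beta>" if "smooth_on U \<alpha>" "\<forall>x\<in>U. \<beta> x = \<alpha> x" for \<alpha> \<beta> :: "'a \<Rightarrow> 'a"
    using smooth_on_cong[OF assms, of \<beta> \<alpha>] that by auto
  then show ?thesis
    using assms
    by (auto simp: codist_module_def smooth_on_const intro: smooth_on_add smooth_on_scaleR)
qed

lemma codist_span_smooth: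
  assumes "open U" "\<And>\<eta>. \<eta> \<in> S \<Longrightarrow> smooth_on U \<eta>" "\<omega> \<in> codist_span U S"
  shows "smooth_on U \<omega>"
  using codist_span_least[OF smooth_codist_module[OF assms(1)], of S] assms(2,3) by auto

text \<open>By the Leibniz rule the derivative of \<open>c \<eta>\<close> combines
  \<open>\<eta>\<close> and \<open>lie_cov \<theta> \<eta>\<close>. Hence it suffices that
  \<open>W\<close> contains both for every generator.\<close>

lemma lie_cov_codist_span:
  assumes "open U" "smooth_on U \<theta>" "codist_module U W" "S \<subseteq> W"
    and "\<And>\<eta>. \<eta> \<in> S \<Longrightarrow> smooth_on U \<eta>" "\<And>\<eta>. \<eta> \<in> S \<Longrightarrow> lie_cov \<theta> \<eta> \<in> W"
    and "\<omega> \<in> codist_span U S"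
  shows "lie_cov \<theta> \<omega> \<in> W"
proof -
  \<comment> \<open>Smoothness and membership in \<open>W\<close> are carried along because the
    rules for deriving sums and multiples use them. The collection is a module, so it contains the
    span as soon as it contains \<open>S\<close>.\<close>
  define X where "X = {\<omega>. smooth_on U \<omega> \<and> \<omega> \<in> W \<and> lie_cov \<theta> \<omega> \<in> W}"
  have "codist_module U X"
    unfolding codist_module_def
  proof (intro conjI ballI allI impI)
    have "lie_cov \<theta> (\<lambda>x. 0) = (\<lambda>x. 0)" by (auto simp: lie_cov_def)
    then show "(\<lambda>x. 0) \<in> X"
      using assms(1,3) by (simp add: X_def codist_module_def smooth_on_const)
  next
    fix \<alpha> \<beta> assume "\<alpha> \<in> X" "\<beta> \<in> X"
    then have *: "smooth_on U \<alpha>" "\<alpha> \<in> W" "lie_cov \<theta> \<alpha> \<in> W"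
        "smooth_on U \<beta>" "\<beta> \<in> W" "lie_cov \<theta> \<beta> \<in> W"
      by (auto simp: X_def)
    have "lie_cov \<theta> (\<lambda>x. \<alpha> x + \<beta> x) \<in> W"
      by (rule codist_module_cong[OF assms(3) codist_module_add[OF assms(3) *(3,6)]
            lie_cov_add[OF *(1,4)]])
    then show "(\<lambda>x. \<alpha> x + \<beta> x) \<in> X"
      by (simp add: X_def smooth_on_add[OF assms(1) *(1,4)] codist_module_add[OF assms(3) *(2,5)])
  next
    fix c :: "'a \<Rightarrow> real" and \<alpha> assume "\<alpha> \<in> X" and c: "smooth_on U c"
    then have *: "smooth_on U \<alpha>" "\<alpha> \<in> W" "lie_cov \<theta> \<alpha> \<in> W"
      by (auto simp: X_def)
    have "lie_cov \<theta> (\<lambda>x. c x *\<^sub>R \<alpha> x) \<in> W"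
      by (rule codist_module_lincomb[OF assms(3) *(2,3) smooth_on_lie_fun[OF assms(1,2) c] c
            lie_cov_scaleR[OF c *(1)]])
    then show "(\<lambda>x. c x *\<^sub>R \<alpha> x) \<in> X"
      by (simp add: X_def smooth_on_scaleR[OF assms(1) c *(1)]
          codist_module_scaleR[OF assms(3) c *(2)])
  next
    fix \<alpha> \<beta> assume "\<alpha> \<in> X" and "\<forall>x\<in>U. \<beta> x = \<alpha> x"
    then have *: "smooth_on U \<alpha>" "\<alpha> \<in> W" "lie_cov \<theta> \<alpha> \<in> W"
      and eq: "\<And>x. x \<in> U \<Longrightarrow> \<beta> x = \<alpha> x"
      by (auto simp: X_def)
    have "lie_cov \<theta> \<beta> \<in> W"
      by (rule codist_module_cong[OF assms(3) *(3) lie_cov_cong[OF assms(1) _ eq]])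
    moreover have "smooth_on U \<beta>"
      using *(1) smooth_on_cong[OF assms(1) eq] by simp
    ultimately show "\<beta> \<in> X"
      by (simp add: X_def codist_module_cong[OF assms(3) *(2) eq])
  qed
  moreover have "S \<subseteq> X" using assms(4-6) by (auto simp: X_def)
  ultimately show ?thesis
    using codist_span_least assms(7) unfolding X_def by blast
qed

lemma codist_sum_module: "open U \<Longrightarrow> codist_module U (codist_sum U A B)"
  by (simp add: codist_sum_def codist_span_module)

lemma codist_sum_upper: "open U \<Longrightarrow> A \<subseteq> codist_sum U A B" "open U \<Longrightarrow> B \<subseteq> codist_sum U A B"
  by (auto simp: codist_sum_def codist_span_superset)

lemma codist_sum_least:
  "codist_module U W \<Longrightarrow> A \<subseteq> W \<Longrightarrow> B \<subseteq> W \<Longrightarrow> codist_sum U A B \<subseteq> W"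
  by (simp add: codist_sum_def codist_span_least)

lemma lie_codist_superset: "open U \<Longrightarrow> \<omega> \<in> \<Omega> \<Longrightarrow> lie_cov \<theta> \<omega> \<in> lie_codist U \<theta> \<Omega>"
  by (simp add: lie_codist_def codist_span_superset)

lemma lie_codist_least:
  "codist_module U W \<Longrightarrow> (\<And>\<omega>. \<omega> \<in> \<Omega> \<Longrightarrow> lie_cov \<theta> \<omega> \<in> W) \<Longrightarrow> lie_codist U \<theta> \<Omega> \<subseteq> W"
  unfolding lie_codist_def by (intro codist_span_least) auto

section \<open>The extended system\<close>

lemma bounded_linear_input_val: "bounded_linear input_val"
  unfolding input_val_def by (rule bounded_linear_vec_nth)

lemma bounded_linear_input_shift: "bounded_linear input_shift"
  unfolding linear_conv_bounded_linear[symmetric]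
  by (rule linearI) (auto simp: input_shift_def vec_eq_iff)

lemma open_ext_region:
  assumes "open M"
  shows "open (ext_region M :: ('a::euclidean_space, 'k::{finite,linorder}) ext_state set)"
proof -
  have "ext_region M = (fst -` M) \<inter> ((\<lambda>p. input_val (snd p)) -` (- {0}) :: ('a, 'k) ext_state set)"
    by (auto simp: ext_region_def)
  moreover have "continuous_on UNIV (\<lambda>p::('a, 'k) ext_state. input_val (snd p))"
    by (rule linear_continuous_on)
       (rule bounded_linear_compose[OF bounded_linear_input_val bounded_linear_snd])
  ultimately show ?thesis
    using assms by (auto intro!: open_Int open_vimage continuous_on_fst)
qed

text \<open>Keeping \<open>U\<close> as a parameter tied to \<open>ext_region M\<close> by an
  equation fixes the type of the input vectors for all lemmas of the locale.\<close>

locale unknown_input_system =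
  fixes M :: "'a::euclidean_space set"
    and f g :: "'a \<Rightarrow> 'a"
    and h :: "'a \<Rightarrow> real"
    and U :: "('a, 'k::{finite,linorder}) ext_state set"
  assumes open_M: "open M"
    and smooth_f: "smooth_on M f"
    and smooth_g: "smooth_on M g"
    and smooth_h: "smooth_on M h"
    and lie_g_h_nonzero: "x \<in> M \<Longrightarrow> lie_fun g h x \<noteq> 0"
    and U_eq: "U = ext_region M"
begin

abbreviation H :: "('a, 'k) ext_state \<Rightarrow> real" where "H \<equiv> ext_h h"
abbreviation F :: "('a, 'k) ext_state \<Rightarrow> ('a, 'k) ext_state" where "F \<equiv> ext_F f"
abbreviation G :: "('a, 'k) ext_state \<Rightarrow> ('a, 'k) ext_state" where "G \<equiv> ext_G g"
abbreviation Obar :: "nat \<Rightarrow> (('a, 'k) ext_state \<Rightarrow> ('a, 'k) ext_state) set"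
  where "Obar \<equiv> ext_Omega U f g h"
abbreviation Otilde :: "nat \<Rightarrow> (('a, 'k) ext_state \<Rightarrow> ('a, 'k) ext_state) set"
  where "Otilde \<equiv> tilde_Omega M U f g h"
text \<open>Covector fields and vector fields share one representation, so \<open>ext_F\<close> also maps a
  covector field \<open>\<omega>\<close> to \<open>[\<omega>, 0]\<close>.\<close>

abbreviation lift :: "('a \<Rightarrow> 'a) \<Rightarrow> ('a, 'k) ext_state \<Rightarrow> ('a, 'k) ext_state" where "lift \<equiv> ext_F"

lemma open_U: "open U"
  unfolding U_eq by (rule open_ext_region[OF open_M])

lemma fst_in_M: "p \<in> U \<Longrightarrow> fst p \<in> M"
  by (auto simp: U_eq ext_region_def)

lemma input_nonzero: "p \<in> U \<Longrightarrow> input_val (snd p) \<noteq> 0"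
  by (auto simp: U_eq ext_region_def)

lemma smooth_on_fst_compose: "smooth_on M \<omega> \<Longrightarrow> smooth_on U (\<lambda>p. \<omega> (fst p))"
  by (rule smooth_on_compose_linear[OF open_U bounded_linear_fst fst_in_M])

lemma smooth_on_input_val: "smooth_on U (\<lambda>p. input_val (snd p))"
  by (rule smooth_on_bounded_linear[OF open_U
        bounded_linear_compose[OF bounded_linear_input_val bounded_linear_snd]])

lemma lift_eq: "lift \<omega> = (\<lambda>p. (\<omega> (fst p), 0))"
  by (auto simp: ext_F_def)

lemma G_eq: "G = (\<lambda>p. (input_val (snd p) *\<^sub>R g (fst p), input_shift (snd p)))"
  by (auto simp: ext_G_def)

lemma ext_h_eq: "ext_h \<psi> = (\<lambda>p. \<psi> (fst p))"
  by (auto simp: ext_h_def)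

lemma smooth_on_lift: "smooth_on M \<omega> \<Longrightarrow> smooth_on U (lift \<omega>)"
  unfolding lift_eq by (intro smooth_on_Pair open_U smooth_on_fst_compose smooth_on_const)

lemma smooth_on_G: "smooth_on U G"
  unfolding G_eq
  by (intro smooth_on_Pair open_U smooth_on_scaleR smooth_on_input_val
      smooth_on_fst_compose[OF smooth_g] smooth_on_bounded_linear
      bounded_linear_compose[OF bounded_linear_input_shift bounded_linear_snd])

lemma smooth_on_ext_h: "smooth_on M \<psi> \<Longrightarrow> smooth_on U (ext_h \<psi>)"
  unfolding ext_h_eq by (rule smooth_on_fst_compose)

lemma has_derivative_fst_compose:
  assumes "smooth_on M \<omega>" "p \<in> U"
  shows "((\<lambda>p. \<omega> (fst p)) has_derivative (\<lambda>q. frechet_derivative \<omega> (at (fst p)) (fst q))) (at p)"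
  using has_derivative_compose[OF
      bounded_linear_imp_has_derivative[OF bounded_linear_fst]
      smooth_on_has_derivative[OF assms(1) fst_in_M[OF assms(2)]]] .

lemma frechet_derivative_lift:
  assumes "smooth_on M \<omega>" "p \<in> U"
  shows "frechet_derivative (lift \<omega>) (at p) q = (frechet_derivative \<omega> (at (fst p)) (fst q), 0)"
proof -
  have "(lift \<omega> has_derivative (\<lambda>q. (frechet_derivative \<omega> (at (fst p)) (fst q), 0))) (at p)"
    unfolding lift_eq by (intro has_derivative_Pair has_derivative_fst_compose[OF assms]) auto
  then show ?thesis by (simp add: frechet_derivative_at[symmetric])
qed

lemma frechet_derivative_ext_h:
  assumes "smooth_on M \<psi>" "p \<in> U"
  shows "frechet_derivative (ext_h \<psi>) (at p) q = frechet_derivative \<psi> (at (fst p)) (fst q)"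
  using has_derivative_fst_compose[OF assms] by (simp add: ext_h_eq frechet_derivative_at[symmetric])

lemma frechet_derivative_G:
  assumes "p \<in> U"
  shows "frechet_derivative G (at p) q =
    (input_val (snd p) *\<^sub>R frechet_derivative g (at (fst p)) (fst q) + input_val (snd q) *\<^sub>R g (fst p),
     input_shift (snd q))"
proof -
  have "(G has_derivative (\<lambda>q. (input_val (snd p) *\<^sub>R frechet_derivative g (at (fst p)) (fst q) +
      input_val (snd q) *\<^sub>R g (fst p), input_shift (snd q)))) (at p)"
    unfolding G_eq
    by (intro has_derivative_Pair has_derivative_scaleR has_derivative_fst_compose smooth_g assms
        bounded_linear_imp_has_derivative
        bounded_linear_compose[OF bounded_linear_input_shift bounded_linear_snd]
        bounded_linear_compose[OF bounded_linear_input_val bounded_linear_snd])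
  then show ?thesis by (simp add: frechet_derivative_at[symmetric])
qed

lemma differential_ext_h:
  assumes "smooth_on M \<psi>" "p \<in> U"
  shows "differential (ext_h \<psi>) p = lift (differential \<psi>) p"
proof -
  have "differential (ext_h \<psi>) p \<bullet> q = lift (differential \<psi>) p \<bullet> q" for q
    unfolding differential_inner[OF smooth_on_linear_derivative[OF smooth_on_ext_h[OF assms(1)] assms(2)]]
      frechet_derivative_ext_h[OF assms]
    by (simp add: lift_eq inner_prod_def
        differential_inner[OF smooth_on_linear_derivative[OF assms(1) fst_in_M[OF assms(2)]]])
  then show ?thesis by (meson vector_eq_rdot)
qed

lemma lie_cov_lift:
  assumes "smooth_on M \<theta>" "smooth_on M \<omega>" "p \<in> U"
  shows "lie_cov (lift \<theta>) (lift \<omega>) p = lift (lie_cov \<theta> \<omega>) p"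
proof -
  have "lie_cov (lift \<theta>) (lift \<omega>) p \<bullet> q = lift (lie_cov \<theta> \<omega>) p \<bullet> q" for q
  proof -
    have "lie_cov (lift \<theta>) (lift \<omega>) p \<bullet> q =
        frechet_derivative (lift \<omega>) (at p) (lift \<theta> p) \<bullet> q +
        lift \<omega> p \<bullet> frechet_derivative (lift \<theta>) (at p) q"
      by (rule lie_cov_inner[OF smooth_on_linear_derivative[OF smooth_on_lift[OF assms(1)] assms(3)]])
    also have "\<dots> = lie_cov \<theta> \<omega> (fst p) \<bullet> fst q"
      unfolding frechet_derivative_lift[OF assms(1,3)] frechet_derivative_lift[OF assms(2,3)]
        lie_cov_inner[OF smooth_on_linear_derivative[OF assms(1) fst_in_M[OF assms(3)]]]
      by (simp add: ext_F_def case_prod_unfold inner_prod_def)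
    also have "\<dots> = lift (lie_cov \<theta> \<omega>) p \<bullet> q"
      by (simp add: ext_F_def case_prod_unfold inner_prod_def)
    finally show ?thesis .
  qed
  then show ?thesis by (meson vector_eq_rdot)
qed

text \<open>The factor \<open>w\<close> in \<open>G\<close> is itself a coordinate of the extended
  state, and its differential gives the component along \<open>dw\<close>, at the least index. The
  \<open>input_shift\<close> part of \<open>G\<close> meets the zero components of
  \<open>lift \<omega>\<close> and drops out.\<close>

lemma lie_cov_G_lift:
  assumes "smooth_on M \<omega>" "p \<in> U"
  shows "lie_cov G (lift \<omega>) p =
    (input_val (snd p) *\<^sub>R lie_cov g \<omega> (fst p), (\<omega> (fst p) \<bullet> g (fst p)) *\<^sub>R axis (Min UNIV) 1)"
    (is "_ = ?r")
proof -
  have "lie_cov G (lift \<omega>) p \<bullet> q = ?r \<bullet> q" for q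
  proof -
    have M: "fst p \<in> M" by (rule fst_in_M[OF assms(2)])
    interpret linear "frechet_derivative \<omega> (at (fst p))"
      using smooth_on_linear_derivative[OF assms(1) M] .
    have "lie_cov G (lift \<omega>) p \<bullet> q =
        frechet_derivative (lift \<omega>) (at p) (G p) \<bullet> q + lift \<omega> p \<bullet> frechet_derivative G (at p) q"
      by (rule lie_cov_inner[OF smooth_on_linear_derivative[OF smooth_on_G assms(2)]])
    also have "\<dots> = input_val (snd p) * (frechet_derivative \<omega> (at (fst p)) (g (fst p)) \<bullet> fst q +
        \<omega> (fst p) \<bullet> frechet_derivative g (at (fst p)) (fst q)) +
        input_val (snd q) * (\<omega> (fst p) \<bullet> g (fst p))"
      unfolding frechet_derivative_lift[OF assms] frechet_derivative_G[OF assms(2)]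
      by (simp add: ext_G_def ext_F_def case_prod_unfold scaleR inner_prod_def inner_add_right
          distrib_left)
    also have "\<dots> = ?r \<bullet> q"
      by (simp add: inner_prod_def lie_cov_inner[OF smooth_on_linear_derivative[OF smooth_g M]]
          inner_axis' input_val_def)
    finally show ?thesis .
  qed
  then show ?thesis by (meson vector_eq_rdot)
qed

text \<open>The component of \<open>L\<^sub>G \<omega>\<close> along \<open>dw\<close> is removed by subtracting a multiple of
  \<open>L\<^sub>G dh\<close>; what remains is exactly the Lie derivative along the rescaled field \<open>g / L\<^sub>g h\<close>.\<close>

lemma lie_cov_G_lift_decomp:
  assumes "smooth_on M \<omega>" "p \<in> U"
  shows "lie_cov G (lift \<omega>) p =
    (input_val (snd p) * lie_fun g h (fst p)) *\<^sub>R lift (lie_cov (\<lambda>x. g x /\<^sub>R lie_fun g h x) \<omega>) p +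
    ((\<omega> (fst p) \<bullet> g (fst p)) / lie_fun g h (fst p)) *\<^sub>R lie_cov G (differential H) p"
proof -
  define l where "l = lie_fun g h"
  define x where "x = fst p"
  have x: "x \<in> M" unfolding x_def by (rule fst_in_M[OF assms(2)])
  have l0: "\<And>x. x \<in> M \<Longrightarrow> l x \<noteq> 0" unfolding l_def by (rule lie_g_h_nonzero)
  have sl: "smooth_on M l" unfolding l_def by (intro smooth_on_lie_fun open_M smooth_g smooth_h)
  have sgl: "smooth_on M (\<lambda>x. g x /\<^sub>R l x)"
    by (intro smooth_on_scaleR smooth_on_inverse open_M sl smooth_g l0)
  \<comment> \<open>Factoring \<open>g\<close> as \<open>l\<close> times the rescaled field produces
    a multiple of \<open>differential l\<close>. Since \<open>L_G dh\<close> consists of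
    \<open>w\<close> times \<open>differential l\<close> and the \<open>dw\<close> component
    \<open>l\<close>, one multiple of it accounts for both extra terms.\<close>
  have "lie_cov g \<omega> x = lie_cov (\<lambda>x. l x *\<^sub>R (g x /\<^sub>R l x)) \<omega> x"
    by (rule lie_cov_cong_field[OF open_M x]) (simp add: l0)
  also have "\<dots> = l x *\<^sub>R lie_cov (\<lambda>x. g x /\<^sub>R l x) \<omega> x + (\<omega> x \<bullet> (g x /\<^sub>R l x)) *\<^sub>R differential l x"
    by (rule lie_cov_scaleR_field[OF sl sgl assms(1) x])
  finally have 1: "lie_cov g \<omega> x = l x *\<^sub>R lie_cov (\<lambda>x. g x /\<^sub>R l x) \<omega> x +
      ((\<omega> x \<bullet> g x) / l x) *\<^sub>R differential l x"
    by (simp add: divide_inverse mult.commute)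
  have "lie_cov G (differential H) p = lie_cov G (lift (differential h)) p"
    by (rule lie_cov_cong[OF open_U assms(2)]) (rule differential_ext_h[OF smooth_h])
  also have "\<dots> = (input_val (snd p) *\<^sub>R differential l x, l x *\<^sub>R axis (Min UNIV) 1)"
    unfolding lie_cov_G_lift[OF smooth_on_differential[OF open_M smooth_h] assms(2)] l_def
      x_def[symmetric]
    by (simp add: lie_cov_differential[OF open_M x smooth_g smooth_h] lie_fun_eq_inner[OF smooth_h x])
  finally show ?thesis
    unfolding lie_cov_G_lift[OF assms] l_def[symmetric] x_def[symmetric] 1
    using l0[OF x] by (simp add: lift_eq x_def[symmetric] scaleR_add_right mult.commute)
qed

definition mu :: "('a, 'k) ext_state \<Rightarrow> real" where "mu = lie_fun G H"

lemma mu_eq: "p \<in> U \<Longrightarrow> mu p = input_val (snd p) * lie_fun g h (fst p)"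
  using smooth_on_linear_derivative[OF smooth_h fst_in_M, of p]
  by (simp add: mu_def lie_fun_def frechet_derivative_ext_h[OF smooth_h] ext_G_def case_prod_unfold
      linear_cmul)

text \<open>Here the condition that \<open>w\<close> is nonzero enters. Division by
  \<open>mu\<close> serves the inclusion of \<open>Otilde\<close> in \<open>Obar\<close>.\<close>

lemma mu_nonzero: "p \<in> U \<Longrightarrow> mu p \<noteq> 0"
  by (simp add: mu_eq input_nonzero lie_g_h_nonzero fst_in_M)

lemma smooth_on_mu: "smooth_on U mu"
  unfolding mu_def by (intro smooth_on_lie_fun open_U smooth_on_G smooth_on_ext_h smooth_h)

lemma smooth_on_phi: "smooth_on M (phi f g h i)"
proof (induction i)
  case (Suc i)
  then show ?case
    unfolding phi.simps
    by (intro smooth_on_scaleR smooth_on_inverse smooth_on_lie_fun smooth_on_lie_bracket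
        open_M smooth_g smooth_h lie_g_h_nonzero)
qed (simp add: smooth_f)

text \<open>The lifted field has no input component and depends on \<open>x\<close> alone, so the
  bracket is \<open>w\<close> times the lifted bracket with \<open>g\<close>. The normalisation of
  \<open>phi\<close> by \<open>L_g h\<close> then turns \<open>w\<close> into
  \<open>mu\<close>.\<close>

lemma lie_bracket_phi_G:
  assumes "p \<in> U"
  shows "lie_bracket (lift (phi f g h i)) G p = mu p *\<^sub>R lift (phi f g h (Suc i)) p"
proof -
  have M: "fst p \<in> M" by (rule fst_in_M[OF assms])
  interpret linear "frechet_derivative (phi f g h i) (at (fst p))"
    using smooth_on_linear_derivative[OF smooth_on_phi M] .
  show ?thesis
    using lie_g_h_nonzero[OF M]
    unfolding lie_bracket_def frechet_derivative_G[OF assms]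
      frechet_derivative_lift[OF smooth_on_phi assms] mu_eq[OF assms]
    by (simp add: ext_F_def ext_G_def case_prod_unfold scaleR scaleR_diff_right
        lie_bracket_def mult.assoc linear_0[OF bounded_linear.linear[OF bounded_linear_input_shift]]
        linear_0[OF bounded_linear.linear[OF bounded_linear_input_val]])
qed

section \<open>Mixed Lie derivatives of the output\<close>

text \<open>Functions are used rather than covectors: on \<open>U\<close> their differentials are
  the generators of \<open>L_codist\<close>, and exactness lets \<open>lie_cov\<close> be traded for
  \<open>lie_fun\<close>.\<close>

definition lieG_h :: "nat \<Rightarrow> ('a, 'k) ext_state \<Rightarrow> real" where "lieG_h j = (lie_fun G ^^ j) H"

text \<open>These are the \<open>A\<^sub>i\<^sub>j\<close> of the opening comment; the derivatives
  along \<open>G\<close> are taken first.\<close>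

definition mixed_lie :: "nat \<Rightarrow> nat \<Rightarrow> ('a, 'k) ext_state \<Rightarrow> real" where
  "mixed_lie i j = lie_fun (lift (phi f g h i)) (lieG_h j)"

lemma lieG_h_0: "lieG_h 0 = H" and lieG_h_Suc: "lieG_h (Suc j) = lie_fun G (lieG_h j)"
  by (simp_all add: lieG_h_def)

lemma smooth_on_lieG_h: "smooth_on U (lieG_h j)"
  by (induction j)
     (simp_all add: lieG_h_0 lieG_h_Suc smooth_on_ext_h smooth_h smooth_on_lie_fun open_U smooth_on_G)

lemma smooth_on_mixed_lie: "smooth_on U (mixed_lie i j)"
  unfolding mixed_lie_def by (intro smooth_on_lie_fun open_U smooth_on_lift smooth_on_phi smooth_on_lieG_h)

text \<open>The bracket of \<open>lift (phi f g h i)\<close> and \<open>G\<close> acts on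
  \<open>lieG_h j\<close> in two ways: as a commutator, and as \<open>mu\<close> times the next
  lifted \<open>phi\<close>.\<close>

lemma mixed_lie_recursion:
  assumes "p \<in> U"
  shows "mu p * mixed_lie (Suc i) j p = mixed_lie i (Suc j) p - lie_fun G (mixed_lie i j) p"
proof -
  interpret linear "frechet_derivative (lieG_h j) (at p)"
    using smooth_on_linear_derivative[OF smooth_on_lieG_h assms] .
  have "lie_fun (lie_bracket (lift (phi f g h i)) G) (lieG_h j) p = mu p * mixed_lie (Suc i) j p"
    unfolding mixed_lie_def lie_fun_def[of _ "lieG_h j"] lie_bracket_phi_G[OF assms] by (simp add: scaleR)
  then show ?thesis
    using lie_fun_lie_bracket[OF open_U assms smooth_on_lift[OF smooth_on_phi] smooth_on_G smooth_on_lieG_h]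
    by (simp add: mixed_lie_def lieG_h_Suc)
qed

text \<open>Solved for the term with index \<open>i + 1\<close>, this drives the induction for \<open>ext_Omega\<close>; solved for
  the one with index \<open>j + 1\<close>, the induction for \<open>tilde_Omega\<close>.\<close>

lemma differential_mixed_lie_recursion:
  assumes "p \<in> U"
  shows "mu p *\<^sub>R differential (mixed_lie (Suc i) j) p + mixed_lie (Suc i) j p *\<^sub>R differential (lieG_h 1) p =
    differential (mixed_lie i (Suc j)) p - lie_cov G (differential (mixed_lie i j)) p"
proof -
  have sG: "smooth_on U (lie_fun G (mixed_lie i j))"
    by (intro smooth_on_lie_fun open_U smooth_on_G smooth_on_mixed_lie)
  have "differential (\<lambda>p. mu p * mixed_lie (Suc i) j p) p =
      differential (\<lambda>p. mixed_lie i (Suc j) p - lie_fun G (mixed_lie i j) p) p"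
    by (rule differential_cong[OF open_U assms mixed_lie_recursion])
  then show ?thesis
    unfolding differential_mult[OF open_U assms smooth_on_mu smooth_on_mixed_lie]
      differential_diff[OF assms smooth_on_mixed_lie sG]
      lie_cov_differential[OF open_U assms smooth_on_G smooth_on_mixed_lie]
    by (simp add: mu_def lieG_h_def)
qed

text \<open>For \<open>j = 0\<close> the differentials are the lifts of the extra generators that
  \<open>Omega\<close> receives at each step.\<close>

lemma differential_mixed_lie_0:
  assumes "p \<in> U"
  shows "differential (mixed_lie i 0) p = lift (lie_cov (phi f g h i) (differential h)) p"
proof -
  have s: "smooth_on M (lie_fun (phi f g h i) h)"
    by (intro smooth_on_lie_fun open_M smooth_on_phi smooth_h)
  have "differential (mixed_lie i 0) p = differential (ext_h (lie_fun (phi f g h i) h)) p"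
    by (rule differential_cong[OF open_U assms])
       (simp add: mixed_lie_def lieG_h_0 lie_fun_def frechet_derivative_ext_h[OF smooth_h],
        simp add: ext_F_def ext_h_def lie_fun_def case_prod_unfold)
  then show ?thesis
    unfolding differential_ext_h[OF s assms]
    by (simp add: ext_F_def case_prod_unfold fst_in_M[OF assms]
        lie_cov_differential[OF open_M _ smooth_on_phi smooth_h])
qed

lemma lie_cov_power_differential:
  assumes "p \<in> U"
  shows "(lie_cov G ^^ j) (differential H) p = differential (lieG_h j) p"
  using assms
proof (induction j arbitrary: p)
  case (Suc j)
  then have "lie_cov G ((lie_cov G ^^ j) (differential H)) p = lie_cov G (differential (lieG_h j)) p"
    by (intro lie_cov_cong[OF open_U])
  then show ?case
    by (simp add: lieG_h_Suc lie_cov_differential[OF open_U Suc.prems smooth_on_G smooth_on_lieG_h])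
qed (simp add: lieG_h_0)

lemma smooth_on_d_lieG_h: "smooth_on U (differential (lieG_h j))"
  by (intro smooth_on_differential open_U smooth_on_lieG_h)

section \<open>Closure properties of the extended codistributions \<open>Obar\<close>\<close>

lemma Obar_module: "codist_module U (Obar m)"
  by (cases m) (simp_all add: codist_span_module codist_sum_module open_U)

declare Omega.simps(2) [simp del] ext_Omega.simps(2) [simp del]

lemma Obar_Suc: "Obar m \<subseteq> Obar (Suc m)"
  and lie_cov_G_Obar: "\<omega> \<in> Obar m \<Longrightarrow> lie_cov G \<omega> \<in> Obar (Suc m)"
  and lie_cov_F_Obar: "\<omega> \<in> Obar m \<Longrightarrow> lie_cov F \<omega> \<in> Obar (Suc m)"
  unfolding ext_Omega.simps
  by (rule subsetD[OF codist_sum_upper(1)[OF open_U]] subsetD[OF codist_sum_upper(2)[OF open_U]]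
      lie_codist_superset[OF open_U] subsetI | assumption)+

lemma Obar_mono: "m \<le> n \<Longrightarrow> Obar m \<subseteq> Obar n"
  by (rule lift_Suc_mono_le[of Obar]) (use Obar_Suc in auto)

lemma d_lieG_h_in_Obar: "differential (lieG_h j) \<in> Obar j"
proof (induction j)
  case 0
  then show ?case by (simp add: lieG_h_0 codist_span_superset open_U)
next
  case (Suc j)
  show ?case
    by (rule codist_module_cong[OF Obar_module lie_cov_G_Obar[OF Suc]])
       (simp add: lieG_h_Suc lie_cov_differential[OF open_U _ smooth_on_G smooth_on_lieG_h])
qed

text \<open>Induction on \<open>i\<close> for all \<open>j\<close>, because the recursion uses the
  previous row at both \<open>j\<close> and \<open>j + 1\<close>. The base row consists of
  derivatives along \<open>F\<close>, since \<open>phi\<close> starts at \<open>f\<close>; each step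
  divides by \<open>mu\<close>.\<close>

lemma d_mixed_lie_in_Obar: "differential (mixed_lie i j) \<in> Obar (Suc (i + j))"
proof (induction i arbitrary: j)
  case 0
  show ?case
    by (rule codist_module_cong[OF Obar_module lie_cov_F_Obar[OF d_lieG_h_in_Obar]])
       (simp_all add: mixed_lie_def lie_cov_differential[OF open_U _ smooth_on_lift[OF smooth_f] smooth_on_lieG_h])
next
  case (Suc i)
  let ?W = "Obar (Suc (Suc i + j))"
  have 1: "differential (mixed_lie i (Suc j)) \<in> ?W"
    using Suc[of "Suc j"] by simp
  have 2: "lie_cov G (differential (mixed_lie i j)) \<in> ?W"
    using lie_cov_G_Obar[OF Suc[of j]] by simp
  have 3: "differential (lieG_h 1) \<in> ?W"
    using d_lieG_h_in_Obar[of 1] Obar_mono[of 1 "Suc (Suc i + j)"] by auto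
  \<comment> \<open>\<open>\<beta>\<close> is the right-hand side of the differentiated recursion,
    hence also \<open>mu\<close> times the wanted differential plus a multiple of
    \<open>differential (lieG_h 1)\<close>.\<close>
  define \<beta> where "\<beta> p = 1 *\<^sub>R differential (mixed_lie i (Suc j)) p +
      (-1) *\<^sub>R lie_cov G (differential (mixed_lie i j)) p" for p
  have \<beta>: "\<beta> \<in> ?W"
    by (rule codist_module_lincomb[OF Obar_module 1 2 smooth_on_const smooth_on_const])
       (rule open_U open_U \<beta>_def)+
  show ?case
  proof (rule codist_module_lincomb[OF Obar_module \<beta> 3])
    show "smooth_on U (\<lambda>p. inverse (mu p))"
      by (intro smooth_on_inverse open_U mu_nonzero smooth_on_mu)
    show "smooth_on U (\<lambda>p. (- 1) * (inverse (mu p) * mixed_lie (Suc i) j p))"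
      by (intro smooth_on_mult smooth_on_const smooth_on_inverse open_U mu_nonzero smooth_on_mu
          smooth_on_mixed_lie)
    fix p assume p: "p \<in> U"
    have "\<beta> p = mu p *\<^sub>R differential (mixed_lie (Suc i) j) p +
      mixed_lie (Suc i) j p *\<^sub>R differential (lieG_h 1) p"
      unfolding differential_mixed_lie_recursion[OF p] by (simp add: \<beta>_def)
    then show "differential (mixed_lie (Suc i) j) p =
       inverse (mu p) *\<^sub>R \<beta> p + ((- 1) * (inverse (mu p) * mixed_lie (Suc i) j p)) *\<^sub>R differential (lieG_h 1) p"
      using mu_nonzero[OF p] by (simp add: scaleR_add_right)
  qed
qed

section \<open>Closure properties of \<open>Omega\<close> and \<open>Otilde\<close>\<close>

abbreviation \<Omega> :: "nat \<Rightarrow> ('a \<Rightarrow> 'a) set" where "\<Omega> \<equiv> Omega M f g h"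
abbreviation g_scaled :: "'a \<Rightarrow> 'a" where "g_scaled \<equiv> \<lambda>x. g x /\<^sub>R lie_fun g h x"

lemma smooth_on_g_scaled: "smooth_on M g_scaled"
  by (intro smooth_on_scaleR smooth_on_inverse smooth_on_lie_fun open_M smooth_g smooth_h
      lie_g_h_nonzero)

lemma smooth_on_Omega: "\<omega> \<in> \<Omega> m \<Longrightarrow> smooth_on M \<omega>"
proof (induction m arbitrary: \<omega>)
  case 0
  show ?case
    by (rule codist_span_smooth[OF open_M _ 0[unfolded Omega.simps]])
       (auto intro: smooth_on_differential open_M smooth_h)
next
  case (Suc m)
  note mod = smooth_codist_module[OF open_M]
  have "\<Omega> (Suc m) \<subseteq> {\<omega>. smooth_on M \<omega>}"
    unfolding Omega.simps
    by (intro codist_sum_least lie_codist_least codist_span_least mod)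
       (use Suc.IH in \<open>auto intro!: smooth_on_lie_cov smooth_on_differential open_M smooth_f
          smooth_on_g_scaled smooth_on_phi smooth_h\<close>)
  then show ?case using Suc.prems by blast
qed

lemma Omega_Suc: "\<Omega> m \<subseteq> \<Omega> (Suc m)"
  and lie_cov_f_Omega: "\<omega> \<in> \<Omega> m \<Longrightarrow> lie_cov f \<omega> \<in> \<Omega> (Suc m)"
  and lie_cov_g_scaled_Omega: "\<omega> \<in> \<Omega> m \<Longrightarrow> lie_cov g_scaled \<omega> \<in> \<Omega> (Suc m)"
  and lie_cov_phi_Omega: "lie_cov (phi f g h m) (differential h) \<in> \<Omega> (Suc m)"
  unfolding Omega.simps
  by (rule subsetD[OF codist_sum_upper(1)[OF open_M]] subsetD[OF codist_sum_upper(2)[OF open_M]]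
      lie_codist_superset[OF open_M] codist_span_superset[OF open_M singletonI] subsetI
      | assumption)+

lemma dh_in_Omega: "differential h \<in> \<Omega> m"
  by (induction m) (use Omega_Suc in \<open>auto simp: codist_span_superset open_M simp del: Omega.simps(2)\<close>)

text \<open>Flattens the nested spans into one set of generators and replaces the iterated Lie
  derivatives of \<open>dh\<close> by exact differentials. The two agree on \<open>U\<close>, which
  suffices because modules ignore values elsewhere.\<close>

lemma Otilde_eq: "Otilde m = codist_span U (lift ` \<Omega> m \<union> {differential (lieG_h j) |j. 1 \<le> j \<and> j \<le> m})"
  (is "_ = codist_span U (_ \<union> ?D)")
proof -
  let ?P = "{(lie_cov G ^^ j) (differential H) |j. 1 \<le> j \<and> j \<le> m}"
  have Otilde: "Otilde m = codist_sum U (codist_span U (lift ` \<Omega> m)) (codist_span U ?P)"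
    by (simp add: tilde_Omega_def codist_lift_def L_codist_def ext_F_def[abs_def])
  have m: "codist_module U (codist_span U S)" for S
    by (rule codist_span_module[OF open_U])
  have P: "(lie_cov G ^^ j) (differential H) \<in> codist_span U S"
    if "differential (lieG_h j) \<in> codist_span U S" for S j
    by (rule codist_module_cong[OF m that lie_cov_power_differential])
  have D: "differential (lieG_h j) \<in> W"
    if "codist_module U W" "(lie_cov G ^^ j) (differential H) \<in> W" for W j
    by (rule codist_module_cong[OF that]) (simp add: lie_cov_power_differential)
  show ?thesis
  proof
    show "Otilde m \<subseteq> codist_span U (lift ` \<Omega> m \<union> ?D)"
      unfolding Otilde
    proof (intro codist_sum_least codist_span_least m)
      show "lift ` \<Omega> m \<subseteq> codist_span U (lift ` \<Omega> m \<union> ?D)"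
        by (auto intro!: codist_span_superset open_U)
      show "?P \<subseteq> codist_span U (lift ` \<Omega> m \<union> ?D)"
        by (auto intro!: P codist_span_superset open_U)
    qed
    show "codist_span U (lift ` \<Omega> m \<union> ?D) \<subseteq> Otilde m"
    proof (rule codist_span_least)
      show mT: "codist_module U (Otilde m)" unfolding Otilde by (rule codist_sum_module[OF open_U])
      have span: "codist_span U (lift ` \<Omega> m) \<subseteq> Otilde m" "codist_span U ?P \<subseteq> Otilde m"
        unfolding Otilde by (rule codist_sum_upper[OF open_U])+
      show "lift ` \<Omega> m \<union> ?D \<subseteq> Otilde m"
      proof (rule Un_least)
        show "lift ` \<Omega> m \<subseteq> Otilde m"
          using codist_span_superset[OF open_U] span(1) by blast
        show "?D \<subseteq> Otilde m"
          by (intro subsetI, elim CollectE exE conjE, hypsubst, rule D[OF mT],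
              rule subsetD[OF span(2)], rule codist_span_superset[OF open_U]) blast
      qed
    qed
  qed
qed

lemma Otilde_module: "codist_module U (Otilde m)"
  unfolding Otilde_eq by (rule codist_span_module[OF open_U])

lemma lift_in_Otilde: "\<omega> \<in> \<Omega> m \<Longrightarrow> lift \<omega> \<in> Otilde m"
  unfolding Otilde_eq by (intro codist_span_superset open_U) auto

lemma d_lieG_h_in_Otilde: "j \<le> m \<Longrightarrow> differential (lieG_h j) \<in> Otilde m"
proof (cases "j = 0")
  \<comment> \<open>The generators of \<open>L_codist\<close> start at index 1, so for
    \<open>j = 0\<close> membership comes from the lift of \<open>differential h\<close>
    instead.\<close>
  case True
  show ?thesis
    unfolding True lieG_h_0
    by (rule codist_module_cong[OF Otilde_module lift_in_Otilde[OF dh_in_Omega]])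
       (rule differential_ext_h[OF smooth_h])
qed (auto simp: Otilde_eq intro!: codist_span_superset open_U)

lemma Otilde_Suc: "Otilde m \<subseteq> Otilde (Suc m)"
  unfolding Otilde_eq[of m]
  by (rule codist_span_least[OF Otilde_module]) (use Omega_Suc in \<open>auto intro!: lift_in_Otilde d_lieG_h_in_Otilde\<close>)

text \<open>By the Leibniz rule only generators matter: lifts are handled by
  \<open>lie_cov_G_lift_decomp\<close>, and on the exact generators the index \<open>j\<close> moves
  to \<open>j + 1\<close>, which \<open>Suc m\<close> admits.\<close>

lemma lie_cov_G_Otilde:
  assumes "\<omega> \<in> Otilde m"
  shows "lie_cov G \<omega> \<in> Otilde (Suc m)"
proof (rule lie_cov_codist_span[OF open_U smooth_on_G Otilde_module])
  show "\<omega> \<in> codist_span U (lift ` \<Omega> m \<union> {differential (lieG_h j) |j. 1 \<le> j \<and> j \<le> m})"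
    using assms unfolding Otilde_eq .
  show "lift ` \<Omega> m \<union> {differential (lieG_h j) |j. 1 \<le> j \<and> j \<le> m} \<subseteq> Otilde (Suc m)"
    using Omega_Suc by (auto intro!: lift_in_Otilde d_lieG_h_in_Otilde)
  fix \<eta> assume "\<eta> \<in> lift ` \<Omega> m \<union> {differential (lieG_h j) |j. 1 \<le> j \<and> j \<le> m}"
  then consider \<omega> where "\<omega> \<in> \<Omega> m" "\<eta> = lift \<omega>" | j where "j \<le> m" "\<eta> = differential (lieG_h j)"
    by blast
  note cases = this
  from cases show "smooth_on U \<eta>"
    by cases (auto intro: smooth_on_lift smooth_on_Omega smooth_on_d_lieG_h)
  \<comment> \<open>The index \<open>j = 0\<close> is included: this instance is
    \<open>L_G dh\<close>, the second term of the decomposition for lifts.\<close>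
  have d_lieG_h: "lie_cov G (differential (lieG_h j)) \<in> Otilde (Suc m)" if "j \<le> m" for j
    by (rule codist_module_cong[OF Otilde_module d_lieG_h_in_Otilde[of "Suc j"]])
       (use that in \<open>simp_all add: lieG_h_Suc lie_cov_differential[OF open_U _ smooth_on_G smooth_on_lieG_h]\<close>)
  from cases show "lie_cov G \<eta> \<in> Otilde (Suc m)"
  proof cases
    case (1 \<omega>)
    note s = smooth_on_Omega[OF 1(1)]
    show ?thesis
      unfolding 1(2)
    proof (rule codist_module_lincomb[OF Otilde_module lift_in_Otilde[OF lie_cov_g_scaled_Omega[OF 1(1)]]
          d_lieG_h[of 0]
          _ _ lie_cov_G_lift_decomp[OF s, folded lieG_h_0]])
      show "smooth_on U (\<lambda>p. input_val (snd p) * lie_fun g h (fst p))"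
        by (intro smooth_on_mult open_U smooth_on_input_val smooth_on_fst_compose
            smooth_on_lie_fun open_M smooth_g smooth_h)
      show "smooth_on U (\<lambda>p. \<omega> (fst p) \<bullet> g (fst p) / lie_fun g h (fst p))"
        unfolding divide_inverse
        by (intro smooth_on_mult smooth_on_inner smooth_on_inverse open_U smooth_on_fst_compose
            smooth_on_lie_fun open_M smooth_g smooth_h s lie_g_h_nonzero fst_in_M)
    qed simp_all
  next
    case 2
    then show ?thesis by (simp add: d_lieG_h)
  qed
qed

lemma Otilde_mono: "m \<le> n \<Longrightarrow> Otilde m \<subseteq> Otilde n"
  by (rule lift_Suc_mono_le[of Otilde]) (use Otilde_Suc in auto)

text \<open>The mirror of \<open>d_mixed_lie_in_Obar\<close>: induction on \<open>j\<close> for all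
  \<open>i\<close>, with the lifted extra generators of \<open>Omega\<close> as base column. Solving
  for index \<open>j + 1\<close> leaves a term with the same index sum and one with a smaller sum
  derived along \<open>G\<close>.\<close>

lemma d_mixed_lie_in_Otilde: "differential (mixed_lie i j) \<in> Otilde (Suc (i + j))"
proof (induction j arbitrary: i)
  case 0
  have "differential (mixed_lie i 0) \<in> Otilde (Suc i)"
    by (rule codist_module_cong[OF Otilde_module lift_in_Otilde[OF lie_cov_phi_Omega]])
       (rule differential_mixed_lie_0)
  then show ?case by simp
next
  case (Suc j)
  let ?W = "Otilde (Suc (i + Suc j))"
  have 1: "differential (mixed_lie (Suc i) j) \<in> ?W"
    using Suc[of "Suc i"] by simp
  have 2: "lie_cov G (differential (mixed_lie i j)) \<in> ?W"
    using lie_cov_G_Otilde[OF Suc[of i]] by simp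
  have 3: "differential (lieG_h 1) \<in> ?W"
    by (rule d_lieG_h_in_Otilde) simp
  define \<beta> where "\<beta> p = mu p *\<^sub>R differential (mixed_lie (Suc i) j) p +
      mixed_lie (Suc i) j p *\<^sub>R differential (lieG_h 1) p" for p
  have \<beta>: "\<beta> \<in> ?W"
    by (rule codist_module_lincomb[OF Otilde_module 1 3 smooth_on_mu smooth_on_mixed_lie]) (rule \<beta>_def)
  show ?case
    by (rule codist_module_lincomb[OF Otilde_module \<beta> 2 smooth_on_const[of _ 1] smooth_on_const[of _ 1]])
       (simp_all add: open_U \<beta>_def differential_mixed_lie_recursion del: One_nat_def)
qed

text \<open>\<open>F\<close> is the lift of \<open>f\<close>, so lifts stay lifts of members of
  \<open>\<Omega> (Suc m)\<close>. The exact generators become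
  \<open>differential (mixed_lie 0 j)\<close>, since \<open>phi\<close> starts at \<open>f\<close>;
  for these the mixed induction was set up.\<close>

lemma lie_cov_F_Otilde:
  assumes "\<omega> \<in> Otilde m"
  shows "lie_cov F \<omega> \<in> Otilde (Suc m)"
proof (rule lie_cov_codist_span[OF open_U smooth_on_lift[OF smooth_f] Otilde_module])
  show "\<omega> \<in> codist_span U (lift ` \<Omega> m \<union> {differential (lieG_h j) |j. 1 \<le> j \<and> j \<le> m})"
    using assms unfolding Otilde_eq .
  show "lift ` \<Omega> m \<union> {differential (lieG_h j) |j. 1 \<le> j \<and> j \<le> m} \<subseteq> Otilde (Suc m)"
    using Omega_Suc by (auto intro!: lift_in_Otilde d_lieG_h_in_Otilde)
  fix \<eta> assume "\<eta> \<in> lift ` \<Omega> m \<union> {differential (lieG_h j) |j. 1 \<le> j \<and> j \<le> m}"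
  then consider \<omega> where "\<omega> \<in> \<Omega> m" "\<eta> = lift \<omega>" | j where "j \<le> m" "\<eta> = differential (lieG_h j)"
    by blast
  note cases = this
  from cases show "smooth_on U \<eta>"
    by cases (auto intro: smooth_on_lift smooth_on_Omega smooth_on_d_lieG_h)
  from cases show "lie_cov F \<eta> \<in> Otilde (Suc m)"
  proof cases
    case 1
    show ?thesis
      unfolding 1(2)
      by (rule codist_module_cong[OF Otilde_module lift_in_Otilde[OF lie_cov_f_Omega[OF 1(1)]]])
         (rule lie_cov_lift[OF smooth_f smooth_on_Omega[OF 1(1)]])
  next
    case 2
    have "differential (mixed_lie 0 j) \<in> Otilde (Suc m)"
      using d_mixed_lie_in_Otilde[of 0 j] Otilde_mono[of "Suc j" "Suc m"] 2(1) by auto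
    then show ?thesis
      unfolding 2(2)
      by (rule codist_module_cong[OF Otilde_module])
         (simp add: mixed_lie_def lie_cov_differential[OF open_U _ smooth_on_lift[OF smooth_f] smooth_on_lieG_h])
  qed
qed

section \<open>The two inclusions between \<open>Obar\<close> and \<open>Otilde\<close>\<close>

lemma Obar_subset_Otilde: "Obar m \<subseteq> Otilde m"
proof (induction m)
  case 0
  have "differential H \<in> Otilde 0" using d_lieG_h_in_Otilde[of 0 0] by (simp add: lieG_h_0)
  then show ?case by (simp add: codist_span_least[OF Otilde_module])
next
  case (Suc m)
  show ?case
    unfolding ext_Omega.simps
    by (intro codist_sum_least lie_codist_least Otilde_module lie_cov_G_Otilde lie_cov_F_Otilde)
       (use Suc Otilde_Suc in auto)
qed

text \<open>Pulls a module on the extended space back to \<open>M\<close>, where the recursive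
  definition of \<open>Omega\<close> can be followed directly. Smooth coefficients on
  \<open>M\<close> become smooth on \<open>U\<close> through \<open>fst\<close>.\<close>

lemma lift_vimage_module:
  assumes "codist_module U W"
  shows "codist_module M {\<omega>. lift \<omega> \<in> W}"
  unfolding codist_module_def mem_Collect_eq Ball_def
proof (intro conjI allI impI)
  show "lift (\<lambda>x. 0) \<in> W"
    using assms by (simp add: codist_module_def lift_eq zero_prod_def)
next
  fix \<alpha> \<beta> assume "lift \<alpha> \<in> W" "lift \<beta> \<in> W"
  then show "lift (\<lambda>x. \<alpha> x + \<beta> x) \<in> W"
    using codist_module_add[OF assms, of "lift \<alpha>" "lift \<beta>"] by (simp add: lift_eq)
next
  fix c :: "'a \<Rightarrow> real" and \<alpha> assume "lift \<alpha> \<in> W" "smooth_on M c"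
  then show "lift (\<lambda>x. c x *\<^sub>R \<alpha> x) \<in> W"
    using codist_module_scaleR[OF assms smooth_on_fst_compose[of c], of "lift \<alpha>"]
    by (simp add: lift_eq)
next
  fix \<alpha> \<beta> assume "lift \<alpha> \<in> W" "\<forall>x. x \<in> M \<longrightarrow> \<beta> x = \<alpha> x"
  then show "lift \<beta> \<in> W"
    by (intro codist_module_cong[OF assms, of "lift \<alpha>" "lift \<beta>"])
       (simp_all add: lift_eq fst_in_M)
qed

text \<open>Derivatives along \<open>f\<close> are matched by \<open>F\<close>, those along the
  rescaled \<open>g\<close> by solving \<open>lie_cov_G_lift_decomp\<close> for its first term, and
  the generators from \<open>phi\<close> by \<open>differential (mixed_lie m 0)\<close>.\<close>

lemma lift_Omega_in_Obar: "\<Omega> m \<subseteq> {\<omega>. lift \<omega> \<in> Obar m}"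
proof (induction m)
  case 0
  have "lift (differential h) \<in> Obar 0"
    by (rule codist_module_cong[OF Obar_module d_lieG_h_in_Obar])
       (simp add: lieG_h_0 differential_ext_h[OF smooth_h])
  then show ?case
    unfolding Omega.simps by (intro codist_span_least lift_vimage_module Obar_module) simp
next
  case (Suc m)
  have lE: "lift \<omega> \<in> Obar (Suc m)" if "\<omega> \<in> \<Omega> m" for \<omega>
    using Suc Obar_Suc that by blast
  have f: "lift (lie_cov f \<omega>) \<in> Obar (Suc m)" if "\<omega> \<in> \<Omega> m" for \<omega>
  proof (rule codist_module_cong[OF Obar_module lie_cov_F_Obar])
    show "lift \<omega> \<in> Obar m" using Suc that by blast
  qed (simp add: lie_cov_lift[OF smooth_f smooth_on_Omega[OF that]])
  have g_scaled: "lift (lie_cov g_scaled \<omega>) \<in> Obar (Suc m)" if "\<omega> \<in> \<Omega> m" for \<omega>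
  proof -
    have s: "smooth_on M \<omega>" by (rule smooth_on_Omega[OF that])
    let ?c = "\<lambda>p. (\<omega> (fst p) \<bullet> g (fst p)) * inverse (lie_fun g h (fst p))"
    have G1: "lie_cov G (lift \<omega>) \<in> Obar (Suc m)"
      using Suc that by (intro lie_cov_G_Obar) blast
    have G2: "lie_cov G (differential H) \<in> Obar (Suc m)"
      using lie_cov_G_Obar[OF d_lieG_h_in_Obar[of 0]] Obar_mono[of "Suc 0" "Suc m"] by (auto simp: lieG_h_0)
    show ?thesis
    proof (rule codist_module_lincomb[OF Obar_module G1 G2])
      show "smooth_on U (\<lambda>p. inverse (mu p))"
        by (intro smooth_on_inverse open_U mu_nonzero smooth_on_mu)
      show "smooth_on U (\<lambda>p. inverse (mu p) * ((- 1) * ?c p))"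
        by (intro smooth_on_mult smooth_on_inner smooth_on_inverse open_U smooth_on_fst_compose
            smooth_on_lie_fun open_M smooth_g smooth_h s lie_g_h_nonzero fst_in_M mu_nonzero
            smooth_on_mu smooth_on_const)
      fix p assume p: "p \<in> U"
      show "lift (lie_cov g_scaled \<omega>) p = inverse (mu p) *\<^sub>R lie_cov G (lift \<omega>) p +
          (inverse (mu p) * ((- 1) * ?c p)) *\<^sub>R lie_cov G (differential H) p"
        unfolding lie_cov_G_lift_decomp[OF s p] mu_eq[OF p, symmetric]
        using mu_nonzero[OF p] by (simp add: scaleR_add_right divide_inverse)
    qed
  qed
  have phi: "lift (lie_cov (phi f g h m) (differential h)) \<in> Obar (Suc m)"
    using d_mixed_lie_in_Obar[of m 0]
    by (intro codist_module_cong[OF Obar_module _ differential_mixed_lie_0[symmetric]]) simp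
  show ?case
    unfolding Omega.simps
    by (intro codist_sum_least lie_codist_least codist_span_least lift_vimage_module Obar_module)
       (use lE f g_scaled phi in auto)
qed

lemma Obar_eq_Otilde: "Obar m = Otilde m"
proof
  show "Otilde m \<subseteq> Obar m"
    unfolding Otilde_eq
    by (rule codist_span_least[OF Obar_module])
       (use lift_Omega_in_Obar d_lieG_h_in_Obar Obar_mono in blast)
qed (rule Obar_subset_Otilde)

end

theorem theorem1:
  fixes M :: "(real ^ 'n) set"
    and f g :: "real ^ 'n \<Rightarrow> real ^ 'n"
    and h :: "real ^ 'n \<Rightarrow> real"
    and U :: "(real ^ 'n, 'k::{finite,linorder}) ext_state set"
    and m :: nat
  assumes "open M"
    and "smooth_on M f"
    and "smooth_on M g"
    and "smooth_on M h"
    and "\<And>x. x \<in> M \<Longrightarrow> lie_fun g h x \<noteq> 0"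
    and "m \<le> CARD('k)"
    and "U = ext_region M"
  shows "ext_Omega U f g h m = tilde_Omega M U f g h m"
proof -
  interpret unknown_input_system M f g h U
    by (unfold_locales; fact assms)
  show ?thesis by (rule Obar_eq_Otilde)
qed

end
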